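(* Let $f$ be a homogeneous polynomial of degree $4$ on $\mathbb{R}^n$ satisfying $|\nabla_x f|^2=16|x|^6$. Then either $f$ is isoparametric, or $f$ is congruent to $(\sum_{i=1}^n x_i^2)^2-8(\sum_{i=1}^k x_i^2)(\sum_{i=k+1}^n x_i^2)$ for some $k\in\{0,1,\ldots,[n/2]\}$.
   Context: A homogeneous polynomial $f$ of degree $g$ on $\mathbb{R}^n$ is called eikonal if $|\nabla_x f|^2=g^2|x|^{2g-2}$. It is called isoparametric if, in addition, $\Delta_x f=\frac{m_2-m_1}{2}g^2|x|^{g-2}$ for some integers $m_1,m_2$ (the Münzner–Cartan equations; equivalently its level sets in the unit sphere are isoparametric hypersurfaces). Two eikonal polynomials $f_1,f_2$ are congruent if $f_2(x)=\pm f_1(Ux)$ for some orthogonal transformation $U$. For a subspace $H\subset\mathbb{R}^n$, writing $\xi,\eta$ for the orthogonal projections of $x$ onto $H$ and $H^\perp$, the primitive quartic is $h_{4,H}=|\xi|^4-6|\xi|^2|\eta|^2+|\eta|^4$; up to congruence these are exactly the polynomials $(\sum_{i=1}^n x_i^2)^2-8(\sum_{i=1}^k x_i^2)(\sum_{i=k+1}^n x_i^2)$, $0\le k\le[n/2]$. *)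

theory Defs
  imports "HOL-Analysis.Analysis"
begin

definition hom_quartic :: "(real ^ 'n \<Rightarrow> real) \<Rightarrow> bool" where
  "hom_quartic f \<longleftrightarrow> (\<exists>c :: 'n \<Rightarrow> 'n \<Rightarrow> 'n \<Rightarrow> 'n \<Rightarrow> real.
     \<forall>x. f x = (\<Sum>i\<in>UNIV. \<Sum>j\<in>UNIV. \<Sum>k\<in>UNIV. \<Sum>l\<in>UNIV.
                   c i j k l * x$i * x$j * x$k * x$l))"

definition partial :: "'n::finite \<Rightarrow> (real ^ 'n \<Rightarrow> real) \<Rightarrow> real ^ 'n \<Rightarrow> real" where
  "partial i f x = deriv (\<lambda>t. f (x + t *\<^sub>R axis i 1)) 0"

definition grad_sq :: "(real ^ 'n::finite \<Rightarrow> real) \<Rightarrow> real ^ 'n \<Rightarrow> real" where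
  "grad_sq f x = (\<Sum>i\<in>UNIV. (partial i f x)^2)"

definition laplacian :: "(real ^ 'n::finite \<Rightarrow> real) \<Rightarrow> real ^ 'n \<Rightarrow> real" where
  "laplacian f x = (\<Sum>i\<in>UNIV. partial i (partial i f) x)"

definition eikonal :: "nat \<Rightarrow> (real ^ 'n::finite \<Rightarrow> real) \<Rightarrow> bool" where
  "eikonal g f \<longleftrightarrow> (\<forall>x. grad_sq f x = real g ^ 2 * norm x ^ (2*g - 2))"

definition isoparametric :: "nat \<Rightarrow> (real ^ 'n::finite \<Rightarrow> real) \<Rightarrow> bool" where
  "isoparametric g f \<longleftrightarrow> eikonal g f \<and>
     (\<exists>m1 m2 :: int. \<forall>x. laplacian f x =
        (real_of_int (m2 - m1) / 2) * real g ^ 2 * norm x ^ (g - 2))"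

definition congruent :: "(real ^ 'n \<Rightarrow> real) \<Rightarrow> (real ^ 'n \<Rightarrow> real) \<Rightarrow> bool" where
  "congruent f1 f2 \<longleftrightarrow> (\<exists>U. orthogonal_transformation U \<and>
     ((\<forall>x. f2 x = f1 (U x)) \<or> (\<forall>x. f2 x = - f1 (U x))))"

text \<open>The quartic (sum_i x_i^2)^2 - 8 (sum_{i in S} x_i^2)(sum_{i not in S} x_i^2);
  the coordinates 1..k are represented by an index set S of cardinality k.\<close>
definition prim_quartic :: "'n::finite set \<Rightarrow> real ^ 'n \<Rightarrow> real" where
  "prim_quartic S x = (\<Sum>i\<in>UNIV. (x$i)^2)^2
      - 8 * (\<Sum>i\<in>S. (x$i)^2) * (\<Sum>i\<in>UNIV - S. (x$i)^2)"

end

theory Submission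
  imports Defs
begin

text \<open>
  Write \<open>f x = T x x x x\<close> with \<open>T\<close> symmetric and four-linear. At a unit vector \<open>e\<close> where \<open>f\<close> attains
  its maximum \<open>1\<close>, comparing coefficients of \<open>s\<close> in the eikonal equation at \<open>e + s y\<close> shows that the
  operator \<open>T e e\<close> has the eigenvalues \<open>1/3\<close> and \<open>-1\<close> on the complement of \<open>e\<close>. Unit vectors \<open>n\<close> of
  the \<open>-1\<close> eigenspace \<open>N e\<close> are again maxima, \<open>(e \<plusminus> n) / \<surd>2\<close> are minima, and \<open>T e n\<close> has the
  eigenvalues \<open>0, \<plusminus>2/3\<close> on the \<open>1/3\<close> eigenspace.

  The Laplacian of \<open>f\<close> is \<open>12\<close> times the trace form \<open>D x x\<close>, the trace of \<open>T x x\<close>. If \<open>dim (N e) \<ge> 2\<close>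
  at all maxima, and likewise at all minima, then the linear function \<open>D e\<close> takes discrete values on
  the unit sphere of \<open>N e\<close>, hence vanishes there, so every extremal point is an eigenvector of \<open>D\<close>;
  the parallelogram law then leaves room for one eigenvalue only. Evaluating it at a maximum and at
  a minimum expresses it by dimensions, which gives the integrality. If instead \<open>dim (N e) \<le> 1\<close> for
  some extremal point \<open>e\<close>, the remaining coefficients force
  \<open>\<plusminus>f x = 2 (R x \<bullet> x)\<^sup>2 - (x \<bullet> x)\<^sup>2\<close> with a symmetric involution \<open>R\<close>, and diagonalising \<open>R\<close> shows
  that \<open>f\<close> is congruent to a primitive quartic.
\<close>

section \<open>Orthonormal bases and traces\<close>

text \<open>Evaluation at 0, 1, -1, 2, -2, 3, -3 gives an invertible Vandermonde system. Polynomials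
  of lower degree are padded with zero coefficients when this is applied.\<close>

lemma poly6_zero_imp_coeffs_zero:
  fixes a0 :: real
  assumes "\<And>r. a0 + a1*r + a2*r^2 + a3*r^3 + a4*r^4 + a5*r^5 + a6*r^6 = 0"
  shows "a0 = 0" "a1 = 0" "a2 = 0" "a3 = 0" "a4 = 0" "a5 = 0" "a6 = 0"
  using assms[of 0] assms[of 1] assms[of "-1"] assms[of 2] assms[of "-2"] assms[of 3] assms[of "-3"]
  by simp_all

lemma inner_left_eqI:
  fixes x y :: "'a::real_inner"
  assumes "\<And>z. z \<bullet> x = z \<bullet> y"
  shows "x = y"
  using assms vector_eq_ldot by blast

lemmas inner_linear = inner_add_left inner_add_right inner_diff_left inner_diff_right

text \<open>Expanding the form at \<open>x + S x\<close>, which lies in \<open>W\<close>, leaves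
  only \<open>2 * (S x \<bullet> S x)\<close>. This upgrades identities of quadratic forms to
  identities of self-adjoint operators.\<close>

lemma symmetric_form_zero_imp_zero:
  fixes S :: "'a::real_inner \<Rightarrow> 'a"
  assumes "linear S" "subspace W" "\<And>x y. S x \<bullet> y = x \<bullet> S y"
    and "\<And>x. x \<in> W \<Longrightarrow> S x \<in> W" "\<And>x. x \<in> W \<Longrightarrow> S x \<bullet> x = 0" "x \<in> W"
  shows "S x = 0"
proof -
  have "S (x + S x) \<bullet> (x + S x) = 0"
    using assms subspace_add by blast
  moreover have "S (S x) \<bullet> S x = 0" "S x \<bullet> x = 0"
    using assms by blast+
  ultimately have "S x \<bullet> S x = 0"
    using assms(3)[of "S x" x]
    by (simp add: linear_add[OF assms(1)] inner_add_left inner_add_right inner_commute)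
  then show ?thesis by simp
qed

text \<open>Comparison of the coefficients of \<open>s\<close> in degrees 2 to 5. The cubic will be
  \<open>G\<close> on the diagonal at \<open>e + s y\<close>, with \<open>Y\<close> standing for
  \<open>y \<bullet> y\<close>.\<close>

lemma cubic_norm_coeffs:
  fixes a u v w :: "'a::real_inner"
  assumes "\<And>s::real. (a + s *\<^sub>R u + s^2 *\<^sub>R v + s^3 *\<^sub>R w) \<bullet> (a + s *\<^sub>R u + s^2 *\<^sub>R v + s^3 *\<^sub>R w)
             = (1 + s^2 * Y)^3"
  shows "u \<bullet> u + 2 * (a \<bullet> v) = 3 * Y" "a \<bullet> w + u \<bullet> v = 0"
    "2 * (u \<bullet> w) + v \<bullet> v = 3 * Y^2" "v \<bullet> w = 0"
proof -
  have "(a \<bullet> a - 1) + (2 * (a \<bullet> u)) * r + (u \<bullet> u + 2 * (a \<bullet> v) - 3 * Y) * r^2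
     + (2 * (a \<bullet> w) + 2 * (u \<bullet> v)) * r^3 + (2 * (u \<bullet> w) + v \<bullet> v - 3 * Y^2) * r^4
     + (2 * (v \<bullet> w)) * r^5 + (w \<bullet> w - Y^3) * r^6 = 0" for r
    using assms[of r]
    by (simp add: inner_add_left inner_add_right inner_commute algebra_simps power_numeral_reduce)
  note c = poly6_zero_imp_coeffs_zero[OF this]
  show "u \<bullet> u + 2 * (a \<bullet> v) = 3 * Y" "a \<bullet> w + u \<bullet> v = 0"
    "2 * (u \<bullet> w) + v \<bullet> v = 3 * Y^2" "v \<bullet> w = 0"
    using c by simp_all
qed

lemma trace_mult_commute:
  fixes A B :: "'a::euclidean_space \<Rightarrow> 'a"
  assumes "linear A" "linear B"
  shows "(\<Sum>b\<in>Basis. A (B b) \<bullet> b) = (\<Sum>b\<in>Basis. B (A b) \<bullet> b)"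
proof -
  have *: "A (B b) \<bullet> b = (\<Sum>c\<in>Basis. (B b \<bullet> c) * (A c \<bullet> b))" if "linear A" for A B :: "'a \<Rightarrow> 'a" and b
  proof -
    have "A (B b) = A (\<Sum>c\<in>Basis. (B b \<bullet> c) *\<^sub>R c)" by (simp add: euclidean_representation)
    also have "\<dots> = (\<Sum>c\<in>Basis. (B b \<bullet> c) *\<^sub>R A c)"
      using that by (simp add: linear_sum linear_scale)
    finally show ?thesis by (simp add: inner_sum_left)
  qed
  have "(\<Sum>b\<in>Basis. A (B b) \<bullet> b) = (\<Sum>b\<in>Basis. \<Sum>c\<in>Basis. (B b \<bullet> c) * (A c \<bullet> b))"
    by (intro sum.cong *[OF assms(1)] refl)
  also have "\<dots> = (\<Sum>c\<in>Basis. \<Sum>b\<in>Basis. (A c \<bullet> b) * (B b \<bullet> c))"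
    by (subst sum.swap) (simp only: mult.commute)
  also have "\<dots> = (\<Sum>c\<in>Basis. B (A c) \<bullet> c)"
    by (intro sum.cong *[OF assms(2), symmetric] refl)
  finally show ?thesis .
qed

text \<open>The difference of the two sides lies in \<open>span C\<close> and is orthogonal to
  \<open>C\<close>, hence to itself.\<close>

lemma orthonormal_expansion:
  fixes C :: "'a::euclidean_space set"
  assumes "pairwise orthogonal C" "\<And>c. c \<in> C \<Longrightarrow> norm c = 1" "finite C" "x \<in> span C"
  shows "(\<Sum>c\<in>C. (x \<bullet> c) *\<^sub>R c) = x"
proof -
  let ?y = "x - (\<Sum>c\<in>C. (x \<bullet> c) *\<^sub>R c)"
  have "?y \<bullet> d = 0" if "d \<in> C" for d
  proof -
    have "(\<Sum>c\<in>C. (x \<bullet> c) * (c \<bullet> d)) = (\<Sum>c\<in>C. if c = d then x \<bullet> d else 0)"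
    proof (rule sum.cong[OF refl])
      show "(x \<bullet> c) * (c \<bullet> d) = (if c = d then x \<bullet> d else 0)" if "c \<in> C" for c
      proof (cases "c = d")
        case True
        then show ?thesis using assms(2)[OF \<open>d \<in> C\<close>] norm_eq_1[of d] by simp
      next
        case False
        then show ?thesis
          using pairwiseD[OF assms(1) that \<open>d \<in> C\<close>] by (simp add: orthogonal_def)
      qed
    qed
    then show ?thesis using that assms(3) by (simp add: inner_diff_left inner_sum_left)
  qed
  then have "orthogonal ?y d" if "d \<in> C" for d using that by (simp add: orthogonal_def)
  moreover have "?y \<in> span C"
    using assms(4) by (intro span_diff span_sum span_scale) (auto intro: span_base)
  ultimately have "orthogonal ?y ?y" using orthogonal_to_span by blast
  then show ?thesis by (simp add: orthogonal_self)
qed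

text \<open>For an orthonormal basis \<open>C\<close> of the range,
  \<open>\<pi> b \<bullet> b\<close> is the sum of the squares of \<open>c \<bullet> b\<close>;
  exchanging the two sums leaves the sum of \<open>c \<bullet> c\<close>, which counts
  \<open>C\<close>.\<close>

lemma trace_projection:
  fixes \<pi> :: "'a::euclidean_space \<Rightarrow> 'a"
  assumes lin: "linear \<pi>" and sym: "\<And>x y. \<pi> x \<bullet> y = x \<bullet> \<pi> y" and idem: "\<And>x. \<pi> (\<pi> x) = \<pi> x"
  shows "(\<Sum>b\<in>Basis. \<pi> b \<bullet> b) = real (dim (range \<pi>))"
proof -
  have "subspace (range \<pi>)" using lin by (simp add: linear_subspace_image)
  then obtain C where C: "C \<subseteq> range \<pi>" "pairwise orthogonal C" "\<And>x. x \<in> C \<Longrightarrow> norm x = 1"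
      "independent C" "card C = dim (range \<pi>)" "span C = range \<pi>"
    using orthonormal_basis_subspace by metis
  have fin: "finite C" using C(4) independent_imp_finite by blast
  have "\<pi> b \<bullet> b = (\<Sum>c\<in>C. (c \<bullet> b) * (c \<bullet> b))" for b
  proof -
    have "\<pi> b = (\<Sum>c\<in>C. (\<pi> b \<bullet> c) *\<^sub>R c)"
      using orthonormal_expansion[OF C(2,3) fin, of "\<pi> b"] C(6) by simp
    then have "\<pi> b \<bullet> b = (\<Sum>c\<in>C. (\<pi> b \<bullet> c) * (c \<bullet> b))"
      by (metis (no_types, lifting) inner_scaleR_left inner_sum_left sum.cong)
    also have "\<dots> = (\<Sum>c\<in>C. (c \<bullet> b) * (c \<bullet> b))"
    proof (rule sum.cong[OF refl])
      fix c assume "c \<in> C"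
      then have "\<pi> c = c" using C(1) idem by auto
      then show "(\<pi> b \<bullet> c) * (c \<bullet> b) = (c \<bullet> b) * (c \<bullet> b)" using sym[of b c] by (simp add: inner_commute)
    qed
    finally show ?thesis .
  qed
  then have "(\<Sum>b\<in>Basis. \<pi> b \<bullet> b) = (\<Sum>c\<in>C. \<Sum>b\<in>Basis. (c \<bullet> b) * (c \<bullet> b))"
    by (simp add: sum.swap[of _ C])
  also have "\<dots> = (\<Sum>c\<in>C. c \<bullet> c)" by (simp flip: euclidean_inner)
  also have "\<dots> = real (dim (range \<pi>))" using C(3,5) by (simp add: norm_eq_1)
  finally show ?thesis .
qed

text \<open>\<open>P 1\<close> and \<open>P (-1)\<close> are the orthogonal projections onto the
  eigenspaces for 1 and -1, and \<open>K\<close> is their difference; its trace is a difference of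
  dimensions.\<close>

lemma trace_integer_of_cube_eq_self:
  fixes K :: "'a::euclidean_space \<Rightarrow> 'a"
  assumes lin: "linear K" and sym: "\<And>x y. K x \<bullet> y = x \<bullet> K y" and cube: "\<And>x. K (K (K x)) = K x"
  shows "\<exists>k::int. (\<Sum>b\<in>Basis. K b \<bullet> b) = of_int k"
proof -
  define P where "P s x = (1/2) *\<^sub>R (K (K x) + s *\<^sub>R K x)" for s :: real and x
  have P: "(\<Sum>b\<in>Basis. P s b \<bullet> b) = real (dim (range (P s)))" if "s = 1 \<or> s = -1" for s
  proof (rule trace_projection)
    show "linear (P s)" by (rule linearI)
      (simp_all add: P_def linear_add[OF lin] linear_scale[OF lin] algebra_simps)
    show "P s x \<bullet> y = x \<bullet> P s y" for x y by (simp add: P_def inner_linear sym)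
    show "P s (P s x) = P s x" for x
    proof (rule inner_left_eqI)
      show "z \<bullet> P s (P s x) = z \<bullet> P s x" for z
        using that by (elim disjE)
          (simp_all add: P_def linear_add[OF lin] linear_scale[OF lin] linear_diff[OF lin]
            linear_neg[OF lin] cube inner_linear field_simps)
    qed
  qed
  have "K b \<bullet> b = P 1 b \<bullet> b - P (-1) b \<bullet> b" for b
    by (simp add: P_def inner_linear field_simps)
  then have "(\<Sum>b\<in>Basis. K b \<bullet> b) = (\<Sum>b\<in>Basis. P 1 b \<bullet> b) - (\<Sum>b\<in>Basis. P (-1) b \<bullet> b)"
    by (simp add: sum_subtractf)
  also have "\<dots> = of_int (int (dim (range (P 1))) - int (dim (range (P (-1)))))"
    by (simp add: P)
  finally show ?thesis by blast
qed

lemma orthonormal_inner_self: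
  fixes C :: "'a::euclidean_space set"
  assumes "pairwise orthogonal C" "\<And>c. c \<in> C \<Longrightarrow> norm c = 1" "finite C" "x \<in> span C"
  shows "x \<bullet> x = (\<Sum>c\<in>C. (x \<bullet> c)^2)"
proof -
  have "x \<bullet> x = x \<bullet> (\<Sum>c\<in>C. (x \<bullet> c) *\<^sub>R c)" using orthonormal_expansion[OF assms] by simp
  then show ?thesis by (simp add: inner_sum_right power2_eq_square)
qed

definition linear_reflection :: "('a::real_inner \<Rightarrow> 'a) \<Rightarrow> bool" where
  "linear_reflection R \<longleftrightarrow> linear R \<and> (\<forall>x y. R x \<bullet> y = x \<bullet> R y) \<and> (\<forall>x. R (R x) = x)"

section \<open>Symmetric quartic forms\<close>

text \<open>The four-linear form is encoded by the vector \<open>G x y z\<close> that represents its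
  last slot, because the gradient of the quartic is then \<open>4 G x x x\<close>. The swaps carry
  linearity from the first slot to the others.\<close>

locale quartic_form =
  fixes G :: "'a::euclidean_space \<Rightarrow> 'a \<Rightarrow> 'a \<Rightarrow> 'a"
  assumes G_swap12: "G x y z = G y x z"
    and G_swap23: "G x y z = G x z y"
    and G_inner_swap: "G x y z \<bullet> w = G x y w \<bullet> z"
    and G_add1: "G (x + x') y z = G x y z + G x' y z"
    and G_scale1: "G (c *\<^sub>R x) y z = c *\<^sub>R G x y z"
begin

definition T :: "'a \<Rightarrow> 'a \<Rightarrow> 'a \<Rightarrow> 'a \<Rightarrow> real" where
  "T x y z w = G x y z \<bullet> w"

lemma G_add2: "G x (y + y') z = G x y z + G x y' z"
  by (metis G_swap12 G_add1)

lemma G_add3: "G x y (z + z') = G x y z + G x y z'"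
  by (metis G_swap23 G_add2)

lemma G_scale2: "G x (c *\<^sub>R y) z = c *\<^sub>R G x y z"
  by (metis G_swap12 G_scale1)

lemma G_scale3: "G x y (c *\<^sub>R z) = c *\<^sub>R G x y z"
  by (metis G_swap23 G_scale2)

lemma G_minus: "G (- x) y z = - G x y z" "G x (- y) z = - G x y z" "G x y (- z) = - G x y z"
  using G_scale1[of "-1"] G_scale2[of _ "-1"] G_scale3[of _ _ "-1"] by simp_all

lemma G_diff: "G (x - x') y z = G x y z - G x' y z" "G x (y - y') z = G x y z - G x y' z"
  "G x y (z - z') = G x y z - G x y z'"
  using G_add1[of x "-x'"] G_add2[of _ y "-y'"] G_add3[of _ _ z "-z'"] by (simp_all add: G_minus)

lemma G_zero: "G 0 y z = 0" "G x 0 z = 0" "G x y 0 = 0"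
  using G_scale1[of 0] G_scale2[of _ 0] G_scale3[of _ _ 0] by simp_all

lemmas G_linear = G_add1 G_add2 G_add3 G_scale1 G_scale2 G_scale3 G_minus G_diff G_zero

lemma linear_G: "linear (G x y)"
  by (rule linearI) (simp_all add: G_linear)

lemma T_swap12: "T x y z w = T y x z w"
  unfolding T_def by (metis G_swap12)

lemma T_swap23: "T x y z w = T x z y w"
  unfolding T_def by (metis G_swap23)

lemma T_swap34: "T x y z w = T x y w z"
  unfolding T_def by (rule G_inner_swap)

lemmas T_swap = T_swap12 T_swap23 T_swap34

lemma T_linear:
  "T (x + x') y z w = T x y z w + T x' y z w" "T x (y + y') z w = T x y z w + T x y' z w"
  "T x y (z + z') w = T x y z w + T x y z' w" "T x y z (w + w') = T x y z w + T x y z w'"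
  "T (x - x') y z w = T x y z w - T x' y z w" "T x (y - y') z w = T x y z w - T x y' z w"
  "T x y (z - z') w = T x y z w - T x y z' w" "T x y z (w - w') = T x y z w - T x y z w'"
  "T (- x) y z w = - T x y z w" "T x (- y) z w = - T x y z w"
  "T x y (- z) w = - T x y z w" "T x y z (- w) = - T x y z w"
  "T (c *\<^sub>R x) y z w = c * T x y z w" "T x (c *\<^sub>R y) z w = c * T x y z w"
  "T x y (c *\<^sub>R z) w = c * T x y z w" "T x y z (c *\<^sub>R w) = c * T x y z w"
  "T 0 y z w = 0" "T x 0 z w = 0" "T x y 0 w = 0" "T x y z 0 = 0"
  unfolding T_def by (simp_all add: G_linear inner_add_left inner_add_right inner_diff_left inner_diff_right)

lemma T_expand: "T (x + r *\<^sub>R y) (x + r *\<^sub>R y) (x + r *\<^sub>R y) (x + r *\<^sub>R y) =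
   T x x x x + 4 * r * T x x x y + 6 * r^2 * T x x y y + 4 * r^3 * T x y y y + r^4 * T y y y y"
  by (simp add: T_linear T_swap algebra_simps power_numeral_reduce)

lemma T_expand_cubic: "T e (x + r *\<^sub>R y) (x + r *\<^sub>R y) (x + r *\<^sub>R y) =
   T e x x x + 3 * r * T e x x y + 3 * r^2 * T e x y y + r^3 * T e y y y"
  by (simp add: T_linear T_swap algebra_simps power_numeral_reduce)

text \<open>The coefficient of \<open>r\<close> at \<open>x + r y\<close> gives the case of two
  equal arguments; a second polarisation at \<open>x + y\<close> separates them.\<close>

lemma T_cubic_polarize:
  assumes "subspace W" "\<And>x. x \<in> W \<Longrightarrow> T a x x x = 0" "x \<in> W" "y \<in> W" "z \<in> W"
  shows "T a x y z = 0"
proof -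
  have *: "T a x x y = 0" if "x \<in> W" "y \<in> W" for x y
  proof -
    have "T a (x + r *\<^sub>R y) (x + r *\<^sub>R y) (x + r *\<^sub>R y) = 0" for r
      using assms that by (simp add: subspace_add subspace_scale)
    then have "T a x x x + (3 * T a x x y) * r + (3 * T a x y y) * r^2 + T a y y y * r^3
        + 0 * r^4 + 0 * r^5 + 0 * r^6 = 0" for r
      by (simp add: T_expand_cubic algebra_simps)
    from poly6_zero_imp_coeffs_zero(2)[OF this] show ?thesis by simp
  qed
  have "T a (x + y) (x + y) z = 0" using assms by (simp add: * subspace_add)
  then show ?thesis using * assms by (simp add: T_linear T_swap23[of a y x z])
qed

lemma G_self_adjoint: "G x y u \<bullet> v = u \<bullet> G x y v"
  by (metis G_inner_swap inner_commute)

definition trace_form :: "'a \<Rightarrow> 'a \<Rightarrow> real" where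
  "trace_form x y = (\<Sum>b\<in>Basis. T x y b b)"

lemma trace_form_linear:
  "trace_form (x + x') y = trace_form x y + trace_form x' y"
  "trace_form x (y + y') = trace_form x y + trace_form x y'"
  "trace_form (c *\<^sub>R x) y = c * trace_form x y"
  "trace_form x (c *\<^sub>R y) = c * trace_form x y"
  "trace_form (- x) y = - trace_form x y"
  "trace_form x (- y) = - trace_form x y"
  "trace_form 0 y = 0"
  "trace_form x 0 = 0"
  by (simp_all add: trace_form_def T_linear sum.distrib sum_distrib_left sum_negf)

lemma trace_form_sym: "trace_form x y = trace_form y x"
  unfolding trace_form_def by (metis T_swap12)

text \<open>Exhibits the quartic as a polynomial in the coordinates, from which its continuity is
  read off in \<open>max_point_exists\<close>.\<close>

lemma T_basis_sum: "T x x x x = (\<Sum>a\<in>Basis. \<Sum>b\<in>Basis. \<Sum>c\<in>Basis. \<Sum>d\<in>Basis.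
    (x \<bullet> a) * ((x \<bullet> b) * ((x \<bullet> c) * ((x \<bullet> d) * T a b c d))))"
proof -
  have lin: "linear (\<lambda>x. T x y z w)" "linear (\<lambda>x. T y x z w)"
    "linear (\<lambda>x. T y z x w)" "linear (\<lambda>x. T y z w x)" for y z w
    by (rule linearI; simp add: T_linear)+
  have exp: "f x = (\<Sum>a\<in>Basis. (x \<bullet> a) * f a)" if "linear f" for f :: "'a \<Rightarrow> real"
  proof -
    have "f x = f (\<Sum>a\<in>Basis. (x \<bullet> a) *\<^sub>R a)" by (simp add: euclidean_representation)
    also have "\<dots> = (\<Sum>a\<in>Basis. (x \<bullet> a) * f a)" using that by (simp add: linear_sum linear_scale)
    finally show ?thesis .
  qed
  have "T x x x x = (\<Sum>a\<in>Basis. (x \<bullet> a) * T a x x x)" by (rule exp[OF lin(1)])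
  also have "\<dots> = (\<Sum>a\<in>Basis. \<Sum>b\<in>Basis. (x \<bullet> a) * ((x \<bullet> b) * T a b x x))"
    by (subst exp[OF lin(2)]) (simp add: sum_distrib_left)
  also have "\<dots> = (\<Sum>a\<in>Basis. \<Sum>b\<in>Basis. \<Sum>c\<in>Basis. (x \<bullet> a) * ((x \<bullet> b) * ((x \<bullet> c) * T a b c x)))"
    by (subst exp[OF lin(3)]) (simp add: sum_distrib_left)
  also have "\<dots> = (\<Sum>a\<in>Basis. \<Sum>b\<in>Basis. \<Sum>c\<in>Basis. \<Sum>d\<in>Basis. (x \<bullet> a) * ((x \<bullet> b) * ((x \<bullet> c) * ((x \<bullet> d) * T a b c d))))"
    by (subst exp[OF lin(4)]) (simp add: sum_distrib_left)
  finally show ?thesis .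
qed

end

section \<open>Maximum points\<close>

locale eikonal_quartic = quartic_form +
  assumes G_eikonal: "G x x x \<bullet> G x x x = (x \<bullet> x)^3"
begin

text \<open>The second condition says that \<open>e\<close> is a critical point of the quartic on
  the unit sphere, with value 1. By \<open>abs_T_le\<close> this value is the largest possible
  there.\<close>

definition max_point :: "'a \<Rightarrow> bool" where
  "max_point e \<longleftrightarrow> e \<bullet> e = 1 \<and> G e e e = e"

definition pos_space :: "'a \<Rightarrow> 'a set" where
  "pos_space e = {x. G e e x = (1/3) *\<^sub>R x}"

definition neg_space :: "'a \<Rightarrow> 'a set" where
  "neg_space e = {x. G e e x = - x}"

lemma subspace_pos: "subspace (pos_space e)"
  by (auto simp: subspace_def pos_space_def G_linear algebra_simps)

lemma subspace_neg: "subspace (neg_space e)"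
  by (auto simp: subspace_def neg_space_def G_linear)

end

locale eikonal_max_point = eikonal_quartic +
  fixes e :: 'a
  assumes e: "max_point e"
begin

lemma ee: "e \<bullet> e = 1" and Geee: "G e e e = e"
  using e by (auto simp: max_point_def)

lemma Teee: "T e e e x = e \<bullet> x"
  by (simp add: T_def Geee)

lemma Tee_pos: "x \<in> pos_space e \<Longrightarrow> T e e x y = (x \<bullet> y) / 3"
  by (simp add: T_def pos_space_def)

lemma Tee_neg: "x \<in> neg_space e \<Longrightarrow> T e e x y = - (x \<bullet> y)"
  by (simp add: T_def neg_space_def)

text \<open>Eigenvectors of the self-adjoint operator \<open>G e e\<close> for distinct eigenvalues
  are orthogonal; \<open>e\<close> itself has eigenvalue 1.\<close>

lemma pos_perp: assumes "x \<in> pos_space e" shows "e \<bullet> x = 0" "x \<bullet> e = 0"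
  using Tee_pos[OF assms, of e] T_swap34[of e e x e] by (simp_all add: Teee inner_commute)

lemma neg_perp: assumes "x \<in> neg_space e" shows "e \<bullet> x = 0" "x \<bullet> e = 0"
  using Tee_neg[OF assms, of e] T_swap34[of e e x e] by (simp_all add: Teee inner_commute)

lemma pos_neg_perp: assumes "x \<in> pos_space e" "y \<in> neg_space e" shows "x \<bullet> y = 0" "y \<bullet> x = 0"
  using Tee_pos[OF assms(1), of y] Tee_neg[OF assms(2), of x] T_swap34[of e e x y]
  by (simp_all add: inner_commute)

section \<open>Spectral decomposition of \<open>G e e\<close>\<close>

text \<open>These are the coefficients of \<open>s\<close> in degrees 2 to 5, up to constant
  factors, of the eikonal equation at \<open>e + s y\<close>, whose squared norm is
  \<open>1 + s^2 * (y \<bullet> y)\<close>.\<close>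

lemma perp_expansion:
  assumes "e \<bullet> y = 0"
  shows "3 * (G e e y \<bullet> G e e y) + 2 * T e e y y = y \<bullet> y"
    "T e y y y + 9 * T e y y (G e e y) = 0"
    "6 * T y y y (G e e y) + 9 * (G e y y \<bullet> G e y y) = 3 * (y \<bullet> y)^2"
    "T y y y (G e y y) = 0"
proof -
  have G3: "G (e + s *\<^sub>R y) (e + s *\<^sub>R y) (e + s *\<^sub>R y) =
        e + s *\<^sub>R (3 *\<^sub>R G e e y) + s^2 *\<^sub>R (3 *\<^sub>R G e y y) + s^3 *\<^sub>R G y y y" for s
  proof -
    have sw: "G y e e = G e e y" "G e y e = G e e y" "G y e y = G e y y" "G y y e = G e y y"
      by (metis G_swap12 G_swap23)+
    show ?thesis
      by (rule inner_left_eqI)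
        (simp add: G_linear Geee sw inner_linear algebra_simps power_numeral_reduce)
  qed
  have "(e + s *\<^sub>R y) \<bullet> (e + s *\<^sub>R y) = 1 + s^2 * (y \<bullet> y)" for s
    using assms by (simp add: inner_add_left inner_add_right inner_commute ee power2_eq_square)
  then have "(e + s *\<^sub>R (3 *\<^sub>R G e e y) + s^2 *\<^sub>R (3 *\<^sub>R G e y y) + s^3 *\<^sub>R G y y y) \<bullet>
     (e + s *\<^sub>R (3 *\<^sub>R G e e y) + s^2 *\<^sub>R (3 *\<^sub>R G e y y) + s^3 *\<^sub>R G y y y) = (1 + s^2 * (y \<bullet> y))^3" for s
    using G_eikonal[of "e + s *\<^sub>R y"] unfolding G3 by simp
  note c = cubic_norm_coeffs[OF this]
  have t: "e \<bullet> G e y y = T e e y y" "e \<bullet> G y y y = T e y y y"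
    "G e e y \<bullet> G e y y = T e y y (G e e y)" "G e e y \<bullet> G y y y = T y y y (G e e y)"
    "G e y y \<bullet> G y y y = T y y y (G e y y)"
    by (metis T_def T_swap inner_commute)+
  show "3 * (G e e y \<bullet> G e e y) + 2 * T e e y y = y \<bullet> y"
    "T e y y y + 9 * T e y y (G e e y) = 0"
    "6 * T y y y (G e e y) + 9 * (G e y y \<bullet> G e y y) = 3 * (y \<bullet> y)^2"
    "T y y y (G e y y) = 0"
    using c by (simp_all add: t)
qed

text \<open>On the complement of \<open>e\<close> the operator \<open>A = G e e\<close> satisfies
  (3A - 1)(A + 1) = 0: the first identity of \<open>perp_expansion\<close> says this for the
  quadratic form, and the operator is self-adjoint. The right-hand side accounts for
  \<open>e\<close>, where 3 + 2 - 1 = 4.\<close>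

lemma Gee_quadratic: "3 *\<^sub>R G e e (G e e x) + 2 *\<^sub>R G e e x - x = (4 * (x \<bullet> e)) *\<^sub>R e"
proof -
  define S where "S x = 3 *\<^sub>R G e e (G e e x) + 2 *\<^sub>R G e e x - x" for x
  have lin: "linear S"
    by (rule linearI) (simp_all add: S_def G_linear algebra_simps)
  have sym: "S x \<bullet> y = x \<bullet> S y" for x y
  proof -
    have a: "G e e u \<bullet> v = u \<bullet> G e e v" for u v by (metis G_inner_swap inner_commute)
    show ?thesis by (simp add: S_def inner_add_left inner_add_right inner_diff_left inner_diff_right a)
  qed
  have Se: "S e = 4 *\<^sub>R e"
    by (rule inner_left_eqI) (simp add: S_def Geee inner_linear)
  let ?W = "{y. e \<bullet> y = 0}"
  have "S y = 0" if "y \<in> ?W" for y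
  proof (rule symmetric_form_zero_imp_zero[OF lin _ sym])
    show "subspace ?W" by (rule subspace_hyperplane)
    show "S x \<in> ?W" if "x \<in> ?W" for x using sym[of e x] that by (simp add: Se)
    show "S x \<bullet> x = 0" if "x \<in> ?W" for x
    proof -
      have "G e e (G e e x) \<bullet> x = G e e x \<bullet> G e e x" by (metis G_inner_swap)
      then show ?thesis using perp_expansion(1)[of x] that
        by (simp add: S_def inner_add_left inner_diff_left T_def)
    qed
  qed fact
  moreover have "e \<bullet> (x - (x \<bullet> e) *\<^sub>R e) = 0" by (simp add: inner_diff_right ee inner_commute)
  ultimately have "S (x - (x \<bullet> e) *\<^sub>R e) = 0" by blast
  then show ?thesis
    using lin by (simp add: linear_diff linear_scale Se S_def[symmetric])
qed

text \<open>The Lagrange projection 3/4 (A + 1) for the eigenvalue 1/3 of \<open>A = G e e\<close>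
  on the complement of \<open>e\<close>; the last term removes its value 3/2 at \<open>e\<close>.
  Likewise \<open>neg_part\<close> is 1/4 (1 - 3A) with its value -1/2 at \<open>e\<close>
  removed.\<close>

definition pos_part :: "'a \<Rightarrow> 'a" where
  "pos_part x = (3/4) *\<^sub>R x + (3/4) *\<^sub>R G e e x - (3/2 * (x \<bullet> e)) *\<^sub>R e"

definition neg_part :: "'a \<Rightarrow> 'a" where
  "neg_part x = (1/4) *\<^sub>R x - (3/4) *\<^sub>R G e e x + (1/2 * (x \<bullet> e)) *\<^sub>R e"

lemma Gee_Gee: "G e e (G e e x) = (1/3) *\<^sub>R x - (2/3) *\<^sub>R G e e x + (4/3 * (x \<bullet> e)) *\<^sub>R e"
proof (rule inner_left_eqI)
  fix z
  show "z \<bullet> G e e (G e e x) = z \<bullet> ((1/3) *\<^sub>R x - (2/3) *\<^sub>R G e e x + (4/3 * (x \<bullet> e)) *\<^sub>R e)"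
    using arg_cong[OF Gee_quadratic[of x], of "\<lambda>v. z \<bullet> v"] by (simp add: inner_linear)
qed

lemma pos_part_in: "pos_part x \<in> pos_space e"
  unfolding pos_space_def mem_Collect_eq
  by (rule inner_left_eqI) (simp add: pos_part_def G_linear Gee_Gee Geee inner_linear algebra_simps)

lemma neg_part_in: "neg_part x \<in> neg_space e"
  unfolding neg_space_def mem_Collect_eq
  by (rule inner_left_eqI) (simp add: neg_part_def G_linear Gee_Gee Geee inner_linear algebra_simps)

lemma decomposition: "x = (x \<bullet> e) *\<^sub>R e + pos_part x + neg_part x"
  by (rule inner_left_eqI) (simp add: pos_part_def neg_part_def inner_linear algebra_simps)

lemma decomposition_eqI:
  assumes "u \<bullet> e = v \<bullet> e" "\<And>p. p \<in> pos_space e \<Longrightarrow> u \<bullet> p = v \<bullet> p"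
    "\<And>n. n \<in> neg_space e \<Longrightarrow> u \<bullet> n = v \<bullet> n"
  shows "u = v"
proof (rule inner_left_eqI)
  fix z
  have "u \<bullet> ((z \<bullet> e) *\<^sub>R e + pos_part z + neg_part z) = v \<bullet> ((z \<bullet> e) *\<^sub>R e + pos_part z + neg_part z)"
    using assms pos_part_in neg_part_in by (simp add: inner_linear)
  then show "z \<bullet> u = z \<bullet> v" using decomposition[of z] by (simp add: inner_commute)
qed

lemma pos_spaceI:
  assumes "u \<bullet> e = 0" "\<And>n. n \<in> neg_space e \<Longrightarrow> u \<bullet> n = 0"
  shows "u \<in> pos_space e"
proof -
  have "u = pos_part u"
  proof (rule decomposition_eqI)
    show "u \<bullet> p = pos_part u \<bullet> p" if "p \<in> pos_space e" for p
      using that arg_cong[OF decomposition[of u], of "\<lambda>x. x \<bullet> p"]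
      by (simp add: inner_add_left pos_perp pos_neg_perp[OF that neg_part_in])
  qed (use assms in \<open>simp_all add: pos_perp[OF pos_part_in] pos_neg_perp[OF pos_part_in]\<close>)
  then show ?thesis using pos_part_in by metis
qed

section \<open>Mixed components of the tensor\<close>

text \<open>In the degree-3 identity of \<open>perp_expansion\<close> at \<open>p + r n\<close>, the
  eigenvalues weight the components differently. Only the coefficient of \<open>T e p p n\<close>
  cancels, as 3 + 6 - 9 = 0, so that component remains free.\<close>

lemma Te_cubic:
  assumes "p \<in> pos_space e" "n \<in> neg_space e"
  shows "T e p p p = 0" "T e p n n = 0" "T e n n n = 0"
proof -
  have "4 * T e p p p + 0 * r + (-12 * T e p n n) * r^2 + (-8 * T e n n n) * r^3
        + 0 * r^4 + 0 * r^5 + 0 * r^6 = 0" for r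
  proof -
    have "G e e (p + r *\<^sub>R n) = (1/3) *\<^sub>R p - r *\<^sub>R n"
      using assms by (simp add: G_linear pos_space_def neg_space_def)
    moreover have "e \<bullet> (p + r *\<^sub>R n) = 0"
      using assms by (simp add: inner_add_right pos_perp neg_perp)
    ultimately have "T e (p + r *\<^sub>R n) (p + r *\<^sub>R n) (p + r *\<^sub>R n)
        + 9 * T e (p + r *\<^sub>R n) (p + r *\<^sub>R n) ((1/3) *\<^sub>R p - r *\<^sub>R n) = 0"
      using perp_expansion(2)[of "p + r *\<^sub>R n"] by simp
    then show ?thesis
      by (simp add: T_linear T_swap algebra_simps power_numeral_reduce)
  qed
  note c = poly6_zero_imp_coeffs_zero[OF this]
  show "T e p p p = 0" "T e p n n = 0" "T e n n n = 0" using c by simp_all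
qed

lemma Te_pos3: "\<lbrakk>p \<in> pos_space e; p' \<in> pos_space e; p'' \<in> pos_space e\<rbrakk> \<Longrightarrow> T e p p' p'' = 0"
  using T_cubic_polarize[OF subspace_pos, of e e] Te_cubic(1) subspace_0[OF subspace_neg] by blast

lemma Te_neg3: "\<lbrakk>n \<in> neg_space e; n' \<in> neg_space e; n'' \<in> neg_space e\<rbrakk> \<Longrightarrow> T e n n' n'' = 0"
  using T_cubic_polarize[OF subspace_neg, of e e] Te_cubic(3) subspace_0[OF subspace_pos] by blast

lemma Te_pos_neg2:
  assumes "p \<in> pos_space e" "n \<in> neg_space e" "n' \<in> neg_space e"
  shows "T e p n n' = 0"
proof -
  have "T e p (n + n') (n + n') = 0"
    using assms by (intro Te_cubic(2) subspace_add[OF subspace_neg])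
  then show ?thesis using assms by (simp add: T_linear Te_cubic(2) T_swap34[of e p n' n])
qed

lemma Ge_neg2:
  assumes "n \<in> neg_space e" "n' \<in> neg_space e"
  shows "G e n n' = - (n \<bullet> n') *\<^sub>R e"
proof (rule decomposition_eqI)
  show "G e n n' \<bullet> e = (- (n \<bullet> n') *\<^sub>R e) \<bullet> e"
    using Tee_neg[OF assms(1), of n'] T_swap[of e n n' e] T_swap[of e n e n'] by (simp add: T_def ee)
next
  fix p assume p: "p \<in> pos_space e"
  have "T e n n' p = T e p n n'" by (simp add: T_swap)
  then show "G e n n' \<bullet> p = (- (n \<bullet> n') *\<^sub>R e) \<bullet> p"
    using Te_pos_neg2[OF p assms] p by (simp add: T_def pos_perp)
next
  fix m assume m: "m \<in> neg_space e"
  show "G e n n' \<bullet> m = (- (n \<bullet> n') *\<^sub>R e) \<bullet> m"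
    using Te_neg3[OF assms m] m by (simp add: T_def neg_perp)
qed

lemma Ge_neg_pos:
  assumes "n \<in> neg_space e" "p \<in> pos_space e"
  shows "G e n p \<in> pos_space e"
proof (rule pos_spaceI)
  have "T e n p e = T e e n p" by (simp add: T_swap)
  then show "G e n p \<bullet> e = 0"
    using Tee_neg[OF assms(1), of p] pos_neg_perp[OF assms(2,1)] by (simp add: T_def)
next
  fix m assume m: "m \<in> neg_space e"
  have "T e n p m = T e p n m" by (simp add: T_swap)
  then show "G e n p \<bullet> m = 0" using Te_pos_neg2[OF assms(2,1) m] by (simp add: T_def)
qed

text \<open>The first four identities are coefficients of \<open>r\<close> in the degree-4 identity
  of \<open>perp_expansion\<close> at \<open>p + r n\<close>, the last two come from the degree-5
  identity.\<close>

lemma T_pos_neg: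
  assumes p: "p \<in> pos_space e" and n: "n \<in> neg_space e"
  shows "2 * T p p p p + 9 * (G e p p \<bullet> G e p p) = 3 * (p \<bullet> p)^2"
    "T p p n n = 3 * (G e n p \<bullet> G e n p) - (p \<bullet> p) * (n \<bullet> n)"
    "T p n n n = 0" "T n n n n = (n \<bullet> n)^2"
    "T p p p (G e p p) = 0"
    "T n n n (G e p p) + 6 * T p n n (G e n p) - 3 * (n \<bullet> n) * T e n p p = 0"
proof -
  define A M where "A = G e p p" and "M = G e n p"
  have M: "M \<in> pos_space e" unfolding M_def by (rule Ge_neg_pos[OF n p])
  have AM: "A \<bullet> M = 0" using Te_pos3[OF p p M] by (simp add: T_def A_def)
  have Ae: "A \<bullet> e = (p \<bullet> p) / 3"
    using Tee_pos[OF p, of p] T_swap[of e p p e] T_swap[of e p e p] by (simp add: T_def A_def)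
  have y: "e \<bullet> (p + r *\<^sub>R n) = 0" for r
    using assms by (simp add: inner_add_right pos_perp neg_perp)
  have L: "G e e (p + r *\<^sub>R n) = (1/3) *\<^sub>R p - r *\<^sub>R n" for r
    using assms by (simp add: G_linear pos_space_def neg_space_def)
  have pn: "G e p n = M" unfolding M_def by (rule G_swap23)
  have Gy: "G e (p + r *\<^sub>R n) (p + r *\<^sub>R n) = A + (2 * r) *\<^sub>R M - (r^2 * (n \<bullet> n)) *\<^sub>R e" for r
    by (rule inner_left_eqI)
      (simp add: G_linear Ge_neg2[OF n n] pn inner_linear A_def[symmetric] M_def[symmetric]
        algebra_simps power2_eq_square)
  have yy: "(p + r *\<^sub>R n) \<bullet> (p + r *\<^sub>R n) = p \<bullet> p + r^2 * (n \<bullet> n)" for r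
    by (simp add: inner_linear pos_neg_perp[OF p n] power2_eq_square)
  have GG: "(A + (2 * r) *\<^sub>R M - (r^2 * (n \<bullet> n)) *\<^sub>R e) \<bullet> (A + (2 * r) *\<^sub>R M - (r^2 * (n \<bullet> n)) *\<^sub>R e)
     = A \<bullet> A + 4 * r^2 * (M \<bullet> M) + r^4 * (n \<bullet> n)^2 - 2/3 * r^2 * (n \<bullet> n) * (p \<bullet> p)" for r
    using AM Ae pos_perp[OF M]
    by (simp add: inner_linear inner_commute ee algebra_simps power_numeral_reduce)
  have "(2 * T p p p p + 9 * (A \<bullet> A) - 3 * (p \<bullet> p)^2) + 0 * r
      + (-12 * T p p n n + 36 * (M \<bullet> M) - 12 * (p \<bullet> p) * (n \<bullet> n)) * r^2
      + (-16 * T p n n n) * r^3 + (6 * (n \<bullet> n)^2 - 6 * T n n n n) * r^4 + 0 * r^5 + 0 * r^6 = 0" for r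
    using perp_expansion(3)[OF y, of r] unfolding L Gy yy GG
    by (simp add: T_linear T_swap algebra_simps power_numeral_reduce)
  note c = poly6_zero_imp_coeffs_zero[OF this]
  show "2 * T p p p p + 9 * (G e p p \<bullet> G e p p) = 3 * (p \<bullet> p)^2"
    "T p p n n = 3 * (G e n p \<bullet> G e n p) - (p \<bullet> p) * (n \<bullet> n)"
    "T p n n n = 0" "T n n n n = (n \<bullet> n)^2"
    using c by (simp_all add: A_def M_def)
  have "T p p p A + (3 * T p p n A + 2 * T p p p M) * r
      + (3 * T p n n A + 6 * T p p n M - (n \<bullet> n) * T e p p p) * r^2
      + (T n n n A + 6 * T p n n M - 3 * (n \<bullet> n) * T e n p p) * r^3
      + (2 * T n n n M - 3 * (n \<bullet> n) * T e p n n) * r^4 + (- (n \<bullet> n) * T e n n n) * r^5 + 0 * r^6 = 0" for r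
    using perp_expansion(4)[OF y, of r] unfolding Gy
    by (simp add: T_linear T_swap algebra_simps power_numeral_reduce)
  note d = poly6_zero_imp_coeffs_zero[OF this]
  show "T p p p (G e p p) = 0"
    "T n n n (G e p p) + 6 * T p n n (G e n p) - 3 * (n \<bullet> n) * T e n p p = 0"
    using d by (simp_all add: A_def M_def)
qed

text \<open>On \<open>neg_space e\<close> the quartic is the fourth power of the norm; its
  polarisation gives the component in \<open>neg_space e\<close>, and the other components vanish by
  the preceding lemmas.\<close>

lemma G_neg3:
  assumes n: "n \<in> neg_space e"
  shows "G n n n = (n \<bullet> n) *\<^sub>R n"
proof (rule decomposition_eqI)
  have "T n n n e = T e n n n" by (simp add: T_swap)
  then show "G n n n \<bullet> e = ((n \<bullet> n) *\<^sub>R n) \<bullet> e"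
    using Te_neg3[OF n n n] n by (simp add: T_def neg_perp)
next
  fix p assume p: "p \<in> pos_space e"
  have "T n n n p = T p n n n" by (simp add: T_swap)
  then show "G n n n \<bullet> p = ((n \<bullet> n) *\<^sub>R n) \<bullet> p"
    using T_pos_neg(3)[OF p n] p n by (simp add: T_def pos_neg_perp)
next
  fix m assume m: "m \<in> neg_space e"
  have "T (n + r *\<^sub>R m) (n + r *\<^sub>R m) (n + r *\<^sub>R m) (n + r *\<^sub>R m) = ((n + r *\<^sub>R m) \<bullet> (n + r *\<^sub>R m))^2" for r
    \<comment> \<open>\<open>T_pos_neg\<close> also asks for a vector of \<open>pos_space e\<close>;
      0 serves.\<close>
    using n m subspace_0[OF subspace_pos]
    by (intro T_pos_neg(4)[of 0] subspace_add subspace_scale subspace_neg)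
  then have "(T n n n n - (n \<bullet> n)^2) + (4 * T n n n m - 4 * (n \<bullet> n) * (n \<bullet> m)) * r
     + (6 * T n n m m - 2 * (n \<bullet> n) * (m \<bullet> m) - 4 * (n \<bullet> m)^2) * r^2
     + (4 * T n m m m - 4 * (m \<bullet> m) * (n \<bullet> m)) * r^3 + (T m m m m - (m \<bullet> m)^2) * r^4
     + 0 * r^5 + 0 * r^6 = 0" for r
    by (simp add: T_expand inner_linear inner_commute[of m n] algebra_simps power_numeral_reduce)
  from poly6_zero_imp_coeffs_zero(2)[OF this] show "G n n n \<bullet> m = ((n \<bullet> n) *\<^sub>R n) \<bullet> m"
    by (simp add: T_def)
qed

lemma max_point_neg:
  assumes "n \<in> neg_space e" "n \<bullet> n = 1" shows "max_point n"
  using assms G_neg3[OF assms(1)] by (simp add: max_point_def)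

lemma min_point_between:
  assumes "n \<in> neg_space e" "n \<bullet> n = 1" and z: "z = (1 / sqrt 2) *\<^sub>R (e + n)"
  shows "z \<bullet> z = 1" "G z z z = - z"
proof -
  show "z \<bullet> z = 1" using assms ee neg_perp by (simp add: z inner_linear)
  have sw: "G n e e = G e e n" "G e n e = G e e n" "G n e n = G e n n" "G n n e = G e n n"
    by (metis G_swap12 G_swap23)+
  have een: "G e e n = - n" using assms by (simp add: neg_space_def)
  \<comment> \<open>The binomial expansion is e - 3n - 3e + n.\<close>
  have "G (e + n) (e + n) (e + n) = - 2 *\<^sub>R (e + n)"
    by (rule inner_left_eqI)
      (simp add: G_linear sw een Geee Ge_neg2[OF assms(1,1)] G_neg3[OF assms(1)] assms(2) inner_linear)
  moreover have "G z z z = ((1 / sqrt 2) * (1 / sqrt 2) * (1 / sqrt 2)) *\<^sub>R G (e + n) (e + n) (e + n)"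
    unfolding z by (simp only: G_scale1 G_scale2 G_scale3 scaleR_scaleR mult.assoc)
  ultimately show "G z z z = - z" by (simp add: z)
qed

section \<open>The operator \<open>G e n\<close>\<close>

text \<open>With \<open>q = G e n p\<close>, the last identity of \<open>T_pos_neg\<close> becomes
  \<open>18 * (q \<bullet> G e n q) = 8 * (n \<bullet> n) * (p \<bullet> q)\<close>. This is the
  claim as a quadratic form in \<open>p\<close>, and the operator is self-adjoint on
  \<open>pos_space e\<close>.\<close>

lemma Ge_neg_cube:
  assumes n: "n \<in> neg_space e" and p: "p \<in> pos_space e"
  shows "G e n (G e n (G e n p)) = (4/9 * (n \<bullet> n)) *\<^sub>R G e n p"
proof -
  define S where "S x = G e n (G e n (G e n x)) - (4/9 * (n \<bullet> n)) *\<^sub>R G e n x" for x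
  have "S p = 0"
  proof (rule symmetric_form_zero_imp_zero[of S "pos_space e"])
    show "linear S" by (rule linearI) (simp_all add: S_def G_linear algebra_simps)
    show "S x \<bullet> y = x \<bullet> S y" for x y by (simp add: S_def inner_linear G_self_adjoint)
    show "S x \<in> pos_space e" if "x \<in> pos_space e" for x
      unfolding S_def using that n
      by (intro subspace_diff[OF subspace_pos] subspace_scale[OF subspace_pos] Ge_neg_pos)
    show "S p \<bullet> p = 0" if p: "p \<in> pos_space e" for p
    proof -
      define q where "q = G e n p"
      have q: "q \<in> pos_space e" unfolding q_def using n p by (rule Ge_neg_pos)
      \<comment> \<open>Polarises the second identity of \<open>T_pos_neg\<close>, to evaluate
        \<open>T p q n n\<close>.\<close>
      have "T (p + q) (p + q) n n = 3 * (G e n (p + q) \<bullet> G e n (p + q)) - ((p + q) \<bullet> (p + q)) * (n \<bullet> n)"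
        by (intro T_pos_neg(2) subspace_add[OF subspace_pos] p q n)
      then have pq: "T p q n n = 3 * (q \<bullet> G e n q) - (p \<bullet> q) * (n \<bullet> n)"
        using T_pos_neg(2)[OF p n] T_pos_neg(2)[OF q n] T_swap12[of p q n n]
        by (simp add: T_linear G_linear inner_linear inner_commute q_def[symmetric] algebra_simps)
      have t: "T n n n (G e p p) = (n \<bullet> n) * (p \<bullet> q)"
      proof -
        have "T n n n (G e p p) = (n \<bullet> n) * T e p p n"
          by (simp add: T_def G_neg3[OF n] inner_commute)
        also have "T e p p n = T e n p p" by (simp add: T_swap)
        finally show ?thesis by (simp add: T_def q_def inner_commute)
      qed
      have "T p n n q = T p q n n" by (simp add: T_swap)
      moreover have "T e n p p = p \<bullet> q" by (simp add: T_def q_def inner_commute)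
      ultimately have "18 * (q \<bullet> G e n q) = 8 * (n \<bullet> n) * (p \<bullet> q)"
        using T_pos_neg(6)[OF p n] by (simp add: t pq q_def[symmetric] algebra_simps)
      then show ?thesis
        by (simp add: S_def inner_linear G_self_adjoint q_def[symmetric] algebra_simps)
           (simp add: q_def G_self_adjoint inner_commute)
    qed
  qed (use p subspace_pos in auto)
  then show ?thesis by (simp add: S_def)
qed

text \<open>Up to the factor \<open>3/2\<close> this is \<open>G e n\<close> with its block on the span of \<open>e\<close>, \<open>n\<close> removed, so that
  \<open>K n\<close> cubed equals \<open>K n\<close> on the whole space while the trace only changes by the factor.\<close>

definition K :: "'a \<Rightarrow> 'a \<Rightarrow> 'a" where
  "K n x = (3/2) *\<^sub>R (G e n x + (x \<bullet> e) *\<^sub>R n + (x \<bullet> n) *\<^sub>R e)"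

lemma linear_K: "linear (K n)"
  by (rule linearI) (simp_all add: K_def G_linear inner_linear algebra_simps)

lemma K_self_adjoint: "K n x \<bullet> y = x \<bullet> K n y"
  using G_self_adjoint[of e n x y] by (simp add: K_def inner_linear inner_commute)

lemma K_pos: "\<lbrakk>n \<in> neg_space e; p \<in> pos_space e\<rbrakk> \<Longrightarrow> K n p = (3/2) *\<^sub>R G e n p"
  by (simp add: K_def pos_perp pos_neg_perp)

lemma K_e: "n \<in> neg_space e \<Longrightarrow> K n e = 0"
  using G_swap23[of e n e] by (simp add: K_def neg_space_def ee neg_perp)

lemma K_neg: "\<lbrakk>n \<in> neg_space e; m \<in> neg_space e\<rbrakk> \<Longrightarrow> K n m = 0"
  by (simp add: K_def Ge_neg2 neg_perp inner_commute)

lemma K_pos_part: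
  assumes "n \<in> neg_space e" shows "K n x = K n (pos_part x)"
proof -
  have "K n x = K n ((x \<bullet> e) *\<^sub>R e + pos_part x + neg_part x)" using decomposition[of x] by simp
  then show ?thesis
    by (simp add: linear_add[OF linear_K] linear_scale[OF linear_K] K_e K_neg assms neg_part_in)
qed

lemma K_in_pos: "n \<in> neg_space e \<Longrightarrow> K n x \<in> pos_space e"
  by (subst K_pos_part) (simp_all add: K_pos pos_part_in Ge_neg_pos subspace_scale[OF subspace_pos])

lemma K_cube:
  assumes "n \<in> neg_space e" "n \<bullet> n = 1" shows "K n (K n (K n x)) = K n x"
proof -
  define p where "p = pos_part x"
  have p: "p \<in> pos_space e" unfolding p_def by (rule pos_part_in)
  have "K n (K n (K n p)) = K n p"
    using assms Ge_neg_cube[OF assms(1) p] p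
    by (simp add: K_pos G_linear Ge_neg_pos subspace_scale[OF subspace_pos])
  then show ?thesis using K_pos_part[OF assms(1), of x] by (simp add: p_def)
qed

lemma trace_form_neg_integer:
  assumes "n \<in> neg_space e" "n \<bullet> n = 1"
  shows "\<exists>k::int. 3/2 * trace_form e n = of_int k"
proof -
  have "(\<Sum>b\<in>Basis. K n b \<bullet> b) = 3/2 * (trace_form e n + 2 * (\<Sum>b\<in>Basis. (e \<bullet> b) * (n \<bullet> b)))"
    by (simp add: K_def trace_form_def T_def inner_linear sum.distrib sum_distrib_left algebra_simps inner_commute)
  also have "\<dots> = 3/2 * trace_form e n"
    using assms by (simp add: euclidean_inner[symmetric] neg_perp)
  finally show ?thesis
    using trace_integer_of_cube_eq_self[OF linear_K K_self_adjoint K_cube[OF assms]] by metis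
qed

section \<open>The trace form at a maximum\<close>

lemma linear_pos_part: "linear pos_part"
  by (rule linearI) (simp_all add: pos_part_def G_linear inner_linear algebra_simps add_divide_distrib)

lemma linear_neg_part: "linear neg_part"
  by (rule linearI) (simp_all add: neg_part_def G_linear inner_linear algebra_simps add_divide_distrib)

lemma pos_part_self_adjoint: "pos_part x \<bullet> y = x \<bullet> pos_part y"
  using G_self_adjoint[of e e x y] by (simp add: pos_part_def inner_linear inner_commute)

lemma neg_part_self_adjoint: "neg_part x \<bullet> y = x \<bullet> neg_part y"
  using G_self_adjoint[of e e x y] by (simp add: neg_part_def inner_linear inner_commute)

lemma pos_part_pos: assumes "x \<in> pos_space e" shows "pos_part x = x"
  using assms by (intro inner_left_eqI[of "pos_part x"])
    (simp add: pos_part_def pos_perp pos_space_def inner_linear)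

lemma neg_part_neg: assumes "x \<in> neg_space e" shows "neg_part x = x"
  using assms by (intro inner_left_eqI[of "neg_part x"])
    (simp add: neg_part_def neg_perp neg_space_def inner_linear)

text \<open>The projection \<open>neg_part\<close> has trace \<open>dim (neg_space e)\<close>; its
  defining formula expresses the same trace through \<open>trace_form e e\<close>.\<close>

lemma trace_form_e_e: "trace_form e e = (DIM('a) + 2) / 3 - 4/3 * dim (neg_space e)"
proof -
  have "range neg_part = neg_space e"
    using neg_part_in neg_part_neg by (metis image_iff image_subset_iff rangeI subsetI subset_antisym)
  then have "real (dim (neg_space e)) = (\<Sum>b\<in>Basis. neg_part b \<bullet> b)"
    using trace_projection[OF linear_neg_part neg_part_self_adjoint] neg_part_in neg_part_neg by metis
  also have "\<dots> = (\<Sum>b::'a\<in>Basis. 1/4 * (b \<bullet> b)) - 3/4 * trace_form e e + 1/2 * (\<Sum>b\<in>Basis. (e \<bullet> b) * (e \<bullet> b))"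
    by (simp add: neg_part_def trace_form_def T_def inner_linear sum.distrib sum_subtractf
        sum_distrib_left inner_commute algebra_simps)
  also have "(\<Sum>b::'a\<in>Basis. 1/4 * (b \<bullet> b)) = DIM('a) / 4" by (simp add: inner_Basis)
  finally show ?thesis by (simp add: euclidean_inner[symmetric] ee field_simps)
qed

text \<open>The bilinear form \<open>T e p\<close> vanishes on \<open>pos_space e\<close> and on its
  complement, spanned by \<open>e\<close> and \<open>neg_space e\<close>. Both diagonal blocks are
  therefore zero, and so is the trace.\<close>

lemma trace_form_e_pos:
  assumes p: "p \<in> pos_space e"
  shows "trace_form e p = 0"
proof -
  \<comment> \<open>For a projection \<open>\<pi>\<close>, the trace of \<open>G e p\<close>
    composed with \<open>\<pi>\<close> equals that of the block compressed by \<open>\<pi>\<close>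
    on both sides.\<close>
  have tr0: "(\<Sum>b\<in>Basis. G e p (\<pi> b) \<bullet> b) = 0"
    if "linear \<pi>" "\<And>x y. \<pi> x \<bullet> y = x \<bullet> \<pi> y" "\<And>x. \<pi> (\<pi> x) = \<pi> x" "\<And>x y. T e p (\<pi> x) (\<pi> y) = 0" for \<pi>
  proof -
    have "(\<Sum>b\<in>Basis. G e p (\<pi> b) \<bullet> b) = (\<Sum>b\<in>Basis. G e p (\<pi> (\<pi> b)) \<bullet> b)" by (simp add: that)
    also have "\<dots> = (\<Sum>b\<in>Basis. \<pi> (G e p (\<pi> b)) \<bullet> b)"
      using trace_mult_commute[of "\<lambda>x. G e p (\<pi> x)" \<pi>] that(1) linear_compose[OF that(1) linear_G]
      by (simp add: o_def)
    also have "\<dots> = 0" using that(2,4) by (simp add: T_def)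
    finally show ?thesis .
  qed
  have "(\<Sum>b\<in>Basis. G e p (pos_part b) \<bullet> b) = 0"
    by (intro tr0 linear_pos_part pos_part_self_adjoint pos_part_pos pos_part_in Te_pos3 p)
  moreover have "(\<Sum>b\<in>Basis. G e p (b - pos_part b) \<bullet> b) = 0"
  proof (rule tr0)
    have d: "x - pos_part x = (x \<bullet> e) *\<^sub>R e + neg_part x" for x using decomposition[of x] by (simp add: algebra_simps)
    have z: "T e p e e = 0" "T e p e m = 0" "T e p m e = 0" "T e p m m' = 0"
      if "m \<in> neg_space e" "m' \<in> neg_space e" for m m'
    proof -
      have "T e p e e = T e e p e" "T e p e m = T e e p m" "T e p m e = T e e p m" by (simp_all add: T_swap)
      then show "T e p e e = 0" "T e p e m = 0" "T e p m e = 0" "T e p m m' = 0"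
        using Tee_pos[OF p] p that by (simp_all add: pos_perp pos_neg_perp Te_pos_neg2)
    qed
    show "T e p (x - pos_part x) (y - pos_part y) = 0" for x y
      unfolding d using z[OF neg_part_in neg_part_in] by (simp add: T_linear)
    show "linear (\<lambda>x. x - pos_part x)"
      by (rule linear_compose_sub[OF linear_ident linear_pos_part])
    show "(x - pos_part x) \<bullet> y = x \<bullet> (y - pos_part y)" for x y
      by (simp add: inner_linear pos_part_self_adjoint)
    show "(x - pos_part x) - pos_part (x - pos_part x) = x - pos_part x" for x
      by (simp add: linear_diff[OF linear_pos_part] pos_part_pos[OF pos_part_in])
  qed
  ultimately show ?thesis
    by (simp add: trace_form_def T_def G_linear inner_linear sum_subtractf)
qed

text \<open>Along the half circle from \<open>c\<close> through \<open>d\<close> to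
  \<open>- c\<close>, the function \<open>h\<close> is continuous and integer valued. A positive
  start would be at least 1 and the end negative, so the value 1/2 would be attained.\<close>

lemma trace_form_neg_nonpos:
  assumes c: "c \<in> neg_space e" "c \<bullet> c = 1" and d: "d \<in> neg_space e" "d \<bullet> d = 1" and cd: "c \<bullet> d = 0"
  shows "trace_form e c \<le> 0"
proof (rule ccontr)
  assume pos: "\<not> trace_form e c \<le> 0"
  define h where "h \<theta> = 3/2 * (cos \<theta> * trace_form e c + sin \<theta> * trace_form e d)" for \<theta>
  have int: "\<exists>k::int. h \<theta> = of_int k" for \<theta>
  proof -
    let ?v = "cos \<theta> *\<^sub>R c + sin \<theta> *\<^sub>R d"
    have "?v \<in> neg_space e" using c d by (simp add: subspace_add subspace_scale subspace_neg)
    moreover have "?v \<bullet> ?v = (cos \<theta>)^2 + (sin \<theta>)^2"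
      using c d cd by (simp add: inner_linear inner_commute[of d c] power2_eq_square)
    then have "?v \<bullet> ?v = 1" by simp
    ultimately show ?thesis
      using trace_form_neg_integer[of ?v] by (simp add: h_def trace_form_linear)
  qed
  obtain k :: int where k: "h 0 = of_int k" using int by blast
  have "h 0 > 0" using pos by (simp add: h_def)
  then have "k \<ge> 1" using k by simp
  then have "h 0 \<ge> 1/2" "h pi \<le> 1/2" using k pos by (simp_all add: h_def)
  moreover have "continuous_on {0..pi} h" unfolding h_def by (intro continuous_intros)
  ultimately obtain \<theta> where "h \<theta> = 1/2" using IVT2'[of h pi "1/2" 0] by auto
  then obtain j :: int where "of_int j = (1/2 :: real)" using int by metis
  then have "of_int (2 * j) = (1 :: real)" by simp
  then have "2 * j = 1" by linarith
  then show False by presburger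
qed

text \<open>The trace form is linear on the negative space and takes discrete values on its unit sphere,
  which is connected as soon as the dimension is at least two.\<close>

lemma trace_form_e_neg:
  assumes dim: "dim (neg_space e) \<ge> 2" and n: "n \<in> neg_space e"
  shows "trace_form e n = 0"
proof -
  obtain C where C: "C \<subseteq> neg_space e" "pairwise orthogonal C" "\<And>x. x \<in> C \<Longrightarrow> norm x = 1"
      "independent C" "card C = dim (neg_space e)" "span C = neg_space e"
    using orthonormal_basis_subspace[OF subspace_neg] by metis
  have "trace_form e c = 0" if "c \<in> C" for c
  proof -
    have "\<not> C \<subseteq> {c}" using C(5) dim card_mono[of "{c}" C] by auto
    then obtain d where d: "d \<in> C" "d \<noteq> c" by blast
    have "c \<bullet> d = 0" using pairwiseD[OF C(2) that d(1)] d(2) by (simp add: orthogonal_def)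
    moreover have "c \<bullet> c = 1" "d \<bullet> d = 1" using C(3) that d(1) by (metis norm_eq_1)+
    moreover have "c \<in> neg_space e" "d \<in> neg_space e" "- c \<in> neg_space e"
      using C(1) that d(1) subspace_neg subspace_neg[THEN Real_Vector_Spaces.subspace_neg] by auto
    ultimately have "trace_form e c \<le> 0" "trace_form e (- c) \<le> 0"
      using trace_form_neg_nonpos[of c d] trace_form_neg_nonpos[of "- c" d] by simp_all
    then show ?thesis by (simp add: trace_form_linear)
  qed
  moreover have "subspace {x. trace_form e x = 0}"
    by (simp add: subspace_def trace_form_linear)
  ultimately have "span C \<subseteq> {x. trace_form e x = 0}" by (intro span_minimal) auto
  then show ?thesis using C(6) n by auto
qed

lemma trace_form_e:
  assumes "dim (neg_space e) \<ge> 2"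
  shows "trace_form e x = trace_form e e * (e \<bullet> x)"
proof -
  have "trace_form e x = trace_form e ((x \<bullet> e) *\<^sub>R e + pos_part x + neg_part x)"
    using decomposition[of x] by simp
  also have "\<dots> = (x \<bullet> e) * trace_form e e"
    using trace_form_e_pos[OF pos_part_in] trace_form_e_neg[OF assms neg_part_in]
    by (simp only: trace_form_linear)
  finally show ?thesis by (simp add: inner_commute)
qed

section \<open>The quartic in adapted coordinates\<close>

lemma quartic_value:
  assumes p: "p \<in> pos_space e" and n: "n \<in> neg_space e" and x: "x = t *\<^sub>R e + p + n"
  shows "T x x x x = t^4 + 2 * t^2 * (p \<bullet> p) - 6 * t^2 * (n \<bullet> n) + 12 * t * T e n p p
    + T p p p p + 4 * T p p p n + 18 * (G e n p \<bullet> G e n p) - 6 * (p \<bullet> p) * (n \<bullet> n) + (n \<bullet> n)^2"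
proof -
  have y: "T y y y y = T p p p p + 4 * T p p p n + 6 * T p p n n + 4 * T p n n n + T n n n n"
    "T e y y y = T e p p p + 3 * T e n p p + 3 * T e p n n + T e n n n"
    "T e e y y = T e e p p + 2 * T e e p n + T e e n n" "T e e e y = 0" if "y = p + n" for y
    using T_expand[of p 1 n] T_expand_cubic[of e p 1 n] T_swap[of e p p n] T_swap[of e p n p] p n
    by (simp_all add: that Teee inner_linear pos_perp neg_perp T_linear T_swap34[of e e n p])
  have "T x x x x = T (p + n) (p + n) (p + n) (p + n) + 4 * t * T e (p + n) (p + n) (p + n)
     + 6 * t^2 * T e e (p + n) (p + n) + 4 * t^3 * T e e e (p + n) + t^4 * T e e e e"
    using T_expand[of "p + n" t e] by (simp add: x add_ac T_swap)
  then show ?thesis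
    using T_pos_neg[OF p n] Te_cubic[OF p n] Tee_pos[OF p] Tee_neg[OF n]
    by (simp add: y Teee ee pos_perp[OF p] neg_perp[OF n] pos_neg_perp[OF p n] algebra_simps)
qed

lemma inner_self_decomposition:
  assumes p: "p \<in> pos_space e" and n: "n \<in> neg_space e" and x: "x = t *\<^sub>R e + p + n"
  shows "x \<bullet> x = t^2 + p \<bullet> p + n \<bullet> n"
  using assms by (simp add: inner_linear pos_perp neg_perp pos_neg_perp ee power2_eq_square)

lemma Ge_pos2_e: "p \<in> pos_space e \<Longrightarrow> G e p p \<bullet> e = (p \<bullet> p) / 3"
  using Tee_pos[of p p] T_swap[of e p p e] T_swap[of e p e p] by (simp add: T_def)

text \<open>Without negative directions \<open>G e p p\<close> is a multiple of \<open>e\<close>, so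
  the first identity of \<open>T_pos_neg\<close> determines the quartic on
  \<open>pos_space e\<close>.\<close>

lemma reflection_dim_0:
  assumes "neg_space e = {0}"
  shows "T x x x x = (x \<bullet> x)^2"
proof -
  define t p where "t = x \<bullet> e" and "p = pos_part x"
  have p: "p \<in> pos_space e" unfolding p_def by (rule pos_part_in)
  have 0: "0 \<in> neg_space e" using assms by simp
  have "neg_part x = 0" using neg_part_in assms by auto
  then have x: "x = t *\<^sub>R e + p + 0" using decomposition[of x] by (simp add: t_def p_def)
  have "G e p p = ((p \<bullet> p) / 3) *\<^sub>R e"
  proof (rule decomposition_eqI)
    show "G e p p \<bullet> q = (((p \<bullet> p) / 3) *\<^sub>R e) \<bullet> q" if "q \<in> pos_space e" for q
      using Te_pos3[OF p p that] that by (simp add: T_def pos_perp)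
  qed (use assms p in \<open>simp_all add: Ge_pos2_e ee\<close>)
  then have "T p p p p = (p \<bullet> p)^2"
    using T_pos_neg(1)[OF p 0] by (simp add: ee power2_eq_square)
  then show ?thesis
    unfolding quartic_value[OF p 0 x] inner_self_decomposition[OF p 0 x]
    by (simp add: T_linear G_linear algebra_simps power_numeral_reduce)
qed

end

section \<open>Focal hypersurfaces\<close>

text \<open>A one-dimensional negative space is the case where the focal variety is a hypersurface.\<close>

locale eikonal_max_point_hypersurface = eikonal_max_point +
  fixes n :: 'a
  assumes n: "n \<in> neg_space e" and nn: "n \<bullet> n = 1" and neg_span: "neg_space e \<subseteq> span {n}"
begin

lemma neg_eq: assumes "m \<in> neg_space e" shows "m = (m \<bullet> n) *\<^sub>R n"
proof -
  obtain k where "m = k *\<^sub>R n" using assms neg_span by (auto simp: span_singleton)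
  then show ?thesis by (simp add: nn)
qed

lemma Ge_pos2:
  assumes p: "p \<in> pos_space e"
  shows "G e p p = ((p \<bullet> p) / 3) *\<^sub>R e + T e n p p *\<^sub>R n"
proof (rule decomposition_eqI)
  show "G e p p \<bullet> e = (((p \<bullet> p) / 3) *\<^sub>R e + T e n p p *\<^sub>R n) \<bullet> e"
    using p n by (simp add: Ge_pos2_e inner_linear neg_perp ee)
  show "G e p p \<bullet> q = (((p \<bullet> p) / 3) *\<^sub>R e + T e n p p *\<^sub>R n) \<bullet> q" if "q \<in> pos_space e" for q
    using Te_pos3[OF p p that] that n by (simp add: T_def pos_perp pos_neg_perp inner_linear)
  show "G e p p \<bullet> m = (((p \<bullet> p) / 3) *\<^sub>R e + T e n p p *\<^sub>R n) \<bullet> m" if m: "m \<in> neg_space e" for m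
  proof -
    have "T e p p n = T e n p p" by (simp add: T_swap)
    then have "T e p p ((m \<bullet> n) *\<^sub>R n) = (m \<bullet> n) * T e n p p" by (simp add: T_linear)
    then have "T e p p m = (m \<bullet> n) * T e n p p" using neg_eq[OF m] by simp
    then show ?thesis using m by (simp add: T_def inner_linear neg_perp inner_commute)
  qed
qed

lemma T_pos4:
  assumes p: "p \<in> pos_space e"
  shows "T p p p p = (p \<bullet> p)^2 - 9/2 * (T e n p p)^2"
proof -
  have "G e p p \<bullet> G e p p = (p \<bullet> p)^2 / 9 + (T e n p p)^2"
    using n by (simp add: Ge_pos2[OF p] inner_linear ee nn neg_perp power2_eq_square)
  then show ?thesis using T_pos_neg(1)[OF p n] by simp
qed

text \<open>Polarising \<open>T_pos4\<close> gives the component in \<open>pos_space e\<close>; the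
  component along \<open>n\<close> is still unknown here.\<close>

lemma G_pos3:
  assumes p: "p \<in> pos_space e"
  shows "G p p p = (p \<bullet> p) *\<^sub>R p - (9/2 * T e n p p) *\<^sub>R G e n p + T p p p n *\<^sub>R n" (is "_ = ?r")
proof (rule decomposition_eqI)
  note M = Ge_neg_pos[OF n p]
  have "T p p p e = T e p p p" by (simp add: T_swap)
  then show "G p p p \<bullet> e = ?r \<bullet> e"
    using Te_pos3[OF p p p] p n M by (simp add: T_def inner_linear neg_perp pos_perp)
  show "G p p p \<bullet> q = ?r \<bullet> q" if q: "q \<in> pos_space e" for q
  proof -
    have "T (p + r *\<^sub>R q) (p + r *\<^sub>R q) (p + r *\<^sub>R q) (p + r *\<^sub>R q)
       = ((p + r *\<^sub>R q) \<bullet> (p + r *\<^sub>R q))^2 - 9/2 * (T e n (p + r *\<^sub>R q) (p + r *\<^sub>R q))^2" for r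
      using p q by (intro T_pos4 subspace_add subspace_scale subspace_pos)
    then have "(T p p p p - (p \<bullet> p)^2 + 9/2 * (T e n p p)^2)
       + (4 * T p p p q - 4 * (p \<bullet> p) * (p \<bullet> q) + 18 * T e n p p * T e n p q) * r
       + (6 * T p p q q - 2 * (p \<bullet> p) * (q \<bullet> q) - 4 * (p \<bullet> q)^2
           + 9 * T e n p p * T e n q q + 18 * (T e n p q)^2) * r^2
       + (4 * T p q q q - 4 * (q \<bullet> q) * (p \<bullet> q) + 18 * T e n q q * T e n p q) * r^3
       + (T q q q q - (q \<bullet> q)^2 + 9/2 * (T e n q q)^2) * r^4 + 0 * r^5 + 0 * r^6 = 0" for r
      unfolding T_expand
      by (simp add: T_linear T_swap34[of e n q p] inner_linear inner_commute[of q p]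
          algebra_simps power_numeral_reduce)
    from poly6_zero_imp_coeffs_zero(2)[OF this] show ?thesis
      using q n by (simp add: T_def inner_linear pos_neg_perp)
  qed
  show "G p p p \<bullet> m = ?r \<bullet> m" if m: "m \<in> neg_space e" for m
  proof -
    have "T p p p m = (m \<bullet> n) * T p p p n" using neg_eq[OF m] T_linear(16) by metis
    then show ?thesis using p M m by (simp add: T_def inner_linear pos_neg_perp inner_commute[of n m])
  qed
qed

text \<open>Write \<sigma> for \<open>T p p p n\<close> and m for \<open>T e n p p\<close>. The
  fifth identity of \<open>T_pos_neg\<close> gives m \<sigma> = 0, and the eikonal equation at
  \<open>p\<close> gives \<sigma>^2 = 9 m^2 (|p|^2 - |K n p|^2). Both cases of the product force
  \<sigma> = 0.\<close>

lemma pos_alternative: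
  assumes p: "p \<in> pos_space e"
  shows "T p p p n = 0" "T e n p p = 0 \<or> K n p \<bullet> K n p = p \<bullet> p"
proof -
  note M = Ge_neg_pos[OF n p]
  define \<sigma> m where "\<sigma> = T p p p n" and "m = T e n p p"
  have "T p p p e = 0" using Te_pos3[OF p p p] by (simp add: T_swap)
  then have m\<sigma>: "m * \<sigma> = 0"
    using T_pos_neg(5)[OF p n] by (simp add: Ge_pos2[OF p] T_linear \<sigma>_def m_def)
  have "G e n p \<bullet> p = m" by (simp add: T_def m_def)
  then have "G p p p \<bullet> G p p p = (p \<bullet> p)^3 - 9 * m^2 * (p \<bullet> p) + 81/4 * m^2 * (G e n p \<bullet> G e n p) + \<sigma>^2"
    unfolding G_pos3[OF p] m_def[symmetric] \<sigma>_def[symmetric]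
    using n p M pos_neg_perp[OF p n] pos_neg_perp[OF M n]
    by (simp add: inner_linear inner_commute[of p "G e n p"] nn algebra_simps power_numeral_reduce)
  then have eq: "\<sigma>^2 = 9 * m^2 * ((p \<bullet> p) - 9/4 * (G e n p \<bullet> G e n p))"
    using G_eikonal[of p] by (simp add: algebra_simps)
  show \<sigma>0: "T p p p n = 0" using m\<sigma> eq by (auto simp: \<sigma>_def[symmetric])
  have "K n p \<bullet> K n p = 9/4 * (G e n p \<bullet> G e n p)"
    by (simp add: K_pos[OF n p])
  then show "T e n p p = 0 \<or> K n p \<bullet> K n p = p \<bullet> p" using eq \<sigma>0 by (auto simp: \<sigma>_def m_def)
qed

lemma T_K: "p \<in> pos_space e \<Longrightarrow> K n p \<bullet> p = 3/2 * T e n p p"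
  by (simp add: K_pos n T_def)

text \<open>The alternative in \<open>pos_alternative\<close> depends on the point; here it becomes
  uniform, the eigenvalue 0 of \<open>K n\<close> on \<open>pos_space e\<close> occurring either
  alone or not at all.\<close>

lemma K_alternative:
  "(\<forall>p\<in>pos_space e. K n p = 0) \<or> (\<forall>p\<in>pos_space e. K n (K n p) = p)"
proof (cases "\<forall>p\<in>pos_space e. T e n p p = 0")
  case True
  have "K n p = 0" if "p \<in> pos_space e" for p
    by (rule symmetric_form_zero_imp_zero[OF linear_K subspace_pos K_self_adjoint])
      (use True that n in \<open>simp_all add: K_in_pos T_K\<close>)
  then show ?thesis by blast
next
  case False
  then obtain p where p: "p \<in> pos_space e" "T e n p p \<noteq> 0" by blast
  have "K n (K n q) = q" if q: "q \<in> pos_space e" for q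
  proof -
    let ?K = "K n"
    define w where "w = q - ?K (?K q)"
    \<comment> \<open>\<open>w\<close> is the kernel component of \<open>q\<close>. Adding it to the
      image component of \<open>p\<close> keeps \<open>?K z \<bullet> z\<close> nonzero, so
      \<open>?K\<close> preserves the norm of \<open>z\<close>; but it kills \<open>w\<close>, which
      must then be 0.\<close>
    define z where "z = ?K (?K p) + w"
    have w: "w \<in> pos_space e" unfolding w_def using q n by (intro subspace_diff subspace_pos K_in_pos)
    have z: "z \<in> pos_space e" unfolding z_def using w n by (intro subspace_add subspace_pos K_in_pos)
    have Kw: "?K w = 0" by (simp add: w_def linear_diff[OF linear_K] K_cube[OF n nn])
    have Kz: "?K z = ?K p" by (simp add: z_def linear_add[OF linear_K] K_cube[OF n nn] Kw)
    have "?K z \<bullet> z = z \<bullet> ?K p" by (simp add: Kz inner_commute)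
    also have "\<dots> = ?K p \<bullet> p"
      using K_self_adjoint[of n z p] Kz by simp
    finally have "?K z \<bullet> z = ?K p \<bullet> p" .
    then have "T e n z z \<noteq> 0" using T_K[OF z] T_K[OF p(1)] p(2) by simp
    then have "?K z \<bullet> ?K z = z \<bullet> z" using pos_alternative(2)[OF z] by blast
    moreover have "z \<bullet> z = ?K p \<bullet> ?K p + w \<bullet> w"
      using K_self_adjoint[of n "?K p" w] K_self_adjoint[of n "?K p" "?K (?K p)"]
      by (simp add: z_def inner_linear Kw K_cube[OF n nn] inner_commute)
    ultimately have "w = 0" by (simp add: Kz)
    then show ?thesis by (simp add: w_def)
  qed
  then show ?thesis by blast
qed

lemma reflection_dim_1:
  "\<exists>R. linear_reflection R \<and> ((\<forall>x. T x x x x = 2 * (R x \<bullet> x)^2 - (x \<bullet> x)^2) \<or>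
     (\<forall>x. T x x x x = - (2 * (R x \<bullet> x)^2 - (x \<bullet> x)^2)))"
proof -
  have neg: "neg_part x = (x \<bullet> n) *\<^sub>R n" for x
    using neg_eq[OF neg_part_in[of x]] neg_part_self_adjoint[of x n] neg_part_neg[OF n] by simp
  have dec: "x = (x \<bullet> e) *\<^sub>R e + pos_part x + (x \<bullet> n) *\<^sub>R n" for x
    using decomposition[of x] neg[of x] by simp
  have sn: "s *\<^sub>R n \<in> neg_space e" for s using n by (simp add: subspace_scale subspace_neg)
  have val: "T x x x x = t^4 + 2 * t^2 * (p \<bullet> p) - 6 * t^2 * s^2 + 12 * t * s * m
      + (p \<bullet> p)^2 - 9/2 * m^2 + 8 * s^2 * (K n p \<bullet> K n p) - 6 * (p \<bullet> p) * s^2 + s^4"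
    and norm: "x \<bullet> x = t^2 + p \<bullet> p + s^2"
    if "t = x \<bullet> e" "p = pos_part x" "s = x \<bullet> n" "m = T e n p p" for x t p s m
  proof -
    have p: "p \<in> pos_space e" unfolding that by (rule pos_part_in)
    have x: "x = t *\<^sub>R e + p + s *\<^sub>R n" using dec that by simp
    show "x \<bullet> x = t^2 + p \<bullet> p + s^2"
      using inner_self_decomposition[OF p sn x] by (simp add: nn power2_eq_square)
    have "G e n p \<bullet> G e n p = 4/9 * (K n p \<bullet> K n p)" by (simp add: K_pos[OF n p])
    then show "T x x x x = t^4 + 2 * t^2 * (p \<bullet> p) - 6 * t^2 * s^2 + 12 * t * s * m
      + (p \<bullet> p)^2 - 9/2 * m^2 + 8 * s^2 * (K n p \<bullet> K n p) - 6 * (p \<bullet> p) * s^2 + s^4"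
      unfolding quartic_value[OF p sn x] T_linear G_linear T_pos4[OF p] pos_alternative(1)[OF p] that(4)[symmetric]
      by (simp add: nn power_numeral_reduce)
  qed
  show ?thesis
  proof (cases "\<forall>p\<in>pos_space e. K n p = 0")
    case True
    \<comment> \<open>The quartic is now a^2 - 6ab + b^2 with b = (x \<bullet> n)^2 and a = x
      \<bullet> x - b, so \<open>R\<close> reflects in the hyperplane orthogonal to
      \<open>n\<close>.\<close>
    define R where "R x = x - (2 * (x \<bullet> n)) *\<^sub>R n" for x
    have "linear_reflection R"
      unfolding linear_reflection_def
    proof (intro conjI allI)
      show "linear R" by (rule linearI) (simp_all add: R_def inner_linear algebra_simps)
      show "R x \<bullet> y = x \<bullet> R y" for x y by (simp add: R_def inner_linear inner_commute)
      show "R (R x) = x" for x by (simp add: R_def inner_linear nn)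
    qed
    moreover have "T x x x x = 2 * (R x \<bullet> x)^2 - (x \<bullet> x)^2" for x
    proof -
      define t p s where "t = x \<bullet> e" and "p = pos_part x" and "s = x \<bullet> n"
      have p: "p \<in> pos_space e" unfolding p_def by (rule pos_part_in)
      have m: "T e n p p = 0" "K n p = 0" using True p T_K[OF p] by simp_all
      have "R x \<bullet> x = x \<bullet> x - 2 * s^2"
        by (simp add: R_def inner_linear s_def inner_commute power2_eq_square)
      then have R: "R x \<bullet> x = t^2 + p \<bullet> p - s^2"
        using norm[OF t_def p_def s_def refl] by simp
      show ?thesis
        unfolding val[OF t_def p_def s_def refl] norm[OF t_def p_def s_def refl] m R
        by (simp add: algebra_simps power_numeral_reduce)
    qed
    ultimately show ?thesis by blast
  next
    case False
    then have KK: "K n (K n p) = p" if "p \<in> pos_space e" for p using K_alternative that by blast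
    \<comment> \<open>Subtracting \<open>(x \<bullet> x)^2\<close> from the quartic leaves -8 t^2
      s^2 + 12 t s m - 9/2 m^2 = -2 (2 t s - 3/2 m)^2, and \<open>R\<close> is the operator whose
      form is 2 t s - 3/2 m.\<close>
    define R where "R x = (x \<bullet> e) *\<^sub>R n + (x \<bullet> n) *\<^sub>R e - K n x" for x
    have "linear_reflection R"
      unfolding linear_reflection_def
    proof (intro conjI allI)
      show "linear R" by (rule linearI)
        (simp_all add: R_def inner_linear linear_add[OF linear_K] linear_scale[OF linear_K] algebra_simps)
      show "R x \<bullet> y = x \<bullet> R y" for x y
        using K_self_adjoint[of n x y] by (simp add: R_def inner_linear inner_commute)
      show "R (R x) = x" for x
      proof -
        have "K n (K n x) = pos_part x"
          using K_pos_part[OF n, of x] KK[OF pos_part_in] by metis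
        moreover have "K n x \<bullet> e = 0" "K n x \<bullet> n = 0"
          using pos_perp[OF K_in_pos[OF n]] pos_neg_perp[OF K_in_pos[OF n] n] by simp_all
        ultimately have "R (R x) = (x \<bullet> n) *\<^sub>R n + (x \<bullet> e) *\<^sub>R e + pos_part x"
          using n by (simp add: R_def inner_linear linear_add[OF linear_K] linear_scale[OF linear_K]
              linear_diff[OF linear_K] K_e K_neg ee nn neg_perp)
        then show ?thesis using dec[of x] by (simp add: add_ac)
      qed
    qed
    moreover have "T x x x x = - (2 * (R x \<bullet> x)^2 - (x \<bullet> x)^2)" for x
    proof -
      define t p s m where "t = x \<bullet> e" and "p = pos_part x" and "s = x \<bullet> n" and "m = T e n p p"
      have p: "p \<in> pos_space e" unfolding p_def by (rule pos_part_in)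
      have K: "K n p \<bullet> K n p = p \<bullet> p" using KK[OF p] K_self_adjoint[of n p "K n p"] by simp
      have "K n x = K n p" using K_pos_part[OF n, of x] by (simp add: p_def)
      moreover have "K n p \<bullet> x = K n p \<bullet> p"
        using calculation K_self_adjoint[of n p x] inner_commute by metis
      ultimately have "K n x \<bullet> x = 3/2 * m" using T_K[OF p] by (simp add: m_def)
      then have R: "R x \<bullet> x = 2 * t * s - 3/2 * m"
        by (simp add: R_def inner_linear t_def s_def inner_commute)
      show ?thesis
        unfolding val[OF t_def p_def s_def m_def] norm[OF t_def p_def s_def m_def] K R
        by (simp add: algebra_simps power_numeral_reduce)
    qed
    ultimately show ?thesis by blast
  qed
qed

end

section \<open>The trace form\<close>

context eikonal_quartic begin

text \<open>Minima of the quartic are maxima of its negative, so every result about maxima transfers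
  to minima.\<close>

lemma eikonal_quartic_uminus: "eikonal_quartic (\<lambda>x y z. - G x y z)"
proof
  show "- G x y z = - G y x z" "- G x y z = - G x z y" for x y z
    using G_swap12[of x y z] G_swap23[of x y z] by simp_all
  show "- G x y z \<bullet> w = - G x y w \<bullet> z" for x y z w using G_inner_swap[of x y z w] by simp
qed (simp_all add: G_linear G_eikonal)

lemma T_uminus: "quartic_form.T (\<lambda>x y z. - G x y z) x y z w = - T x y z w"
  by (simp add: quartic_form.T_def[OF eikonal_quartic.axioms(1)[OF eikonal_quartic_uminus]] T_def)

lemma trace_form_uminus: "quartic_form.trace_form (\<lambda>x y z. - G x y z) x y = - trace_form x y"
  by (simp add: quartic_form.trace_form_def[OF eikonal_quartic.axioms(1)[OF eikonal_quartic_uminus]] T_uminus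
      trace_form_def sum_negf)

text \<open>The Hessian on the sphere at a maximum,
  \<open>12 * T e e y y - 4 * (y \<bullet> y)\<close>, vanishes on \<open>pos_space e\<close> and is
  negative on \<open>neg_space e\<close>, which thus consists of the directions normal to the set of
  maxima.\<close>

definition focal_codim_ge_2 :: bool where
  "focal_codim_ge_2 \<longleftrightarrow> (\<forall>e. max_point e \<longrightarrow> dim (neg_space e) \<ge> 2)"

lemma max_point_uminus_between:
  assumes "max_point e" "n \<in> neg_space e" "n \<bullet> n = 1"
  shows "eikonal_quartic.max_point (\<lambda>x y z. - G x y z) ((1 / sqrt 2) *\<^sub>R (e + n))"
proof -
  interpret eikonal_max_point G e by unfold_locales fact
  show ?thesis
    using min_point_between[OF assms(2,3) refl]
    by (simp add: eikonal_quartic.max_point_def[OF eikonal_quartic_uminus])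
qed

lemma max_point_eigenvector:
  assumes "focal_codim_ge_2" "max_point e"
  shows "trace_form e x = trace_form e e * (e \<bullet> x)"
proof -
  interpret eikonal_max_point G e by unfold_locales fact
  show ?thesis using assms by (intro trace_form_e) (simp add: focal_codim_ge_2_def)
qed

text \<open>\<open>e\<close>, \<open>n\<close> and \<open>z\<close> are all eigenvectors of the
  trace form, and \<open>z\<close> has equal nonzero components along \<open>e\<close> and
  \<open>n\<close>. Pairing with \<open>e\<close> and with \<open>n\<close> equates the three
  eigenvalues.\<close>

lemma neg_space_eigenvector:
  assumes "focal_codim_ge_2" "eikonal_quartic.focal_codim_ge_2 (\<lambda>x y z. - G x y z)"
    and e: "max_point e" and n: "n \<in> neg_space e" and nn: "n \<bullet> n = 1"
    and z: "z = (1 / sqrt 2) *\<^sub>R (e + n)"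
  shows "trace_form z z = trace_form e e" "trace_form n x = trace_form e e * (n \<bullet> x)"
proof -
  interpret eikonal_max_point G e by unfold_locales fact
  have De: "trace_form e x = trace_form e e * (e \<bullet> x)" for x
    by (rule max_point_eigenvector) fact+
  have Dn: "trace_form n x = trace_form n n * (n \<bullet> x)" for x
    by (intro max_point_eigenvector assms max_point_neg)
  have Dz: "trace_form z x = trace_form z z * (z \<bullet> x)" for x
    using eikonal_quartic.max_point_eigenvector[OF eikonal_quartic_uminus assms(2), of z x]
      max_point_uminus_between[OF e n nn]
    by (simp add: z trace_form_uminus)
  have en: "e \<bullet> n = 0" "trace_form e n = 0" "trace_form n e = 0"
    using De[of n] neg_perp[OF n] by (simp_all add: trace_form_sym)
  have "trace_form z e = (1 / sqrt 2) * trace_form e e" "trace_form z n = (1 / sqrt 2) * trace_form n n"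
    using en by (simp_all add: z trace_form_linear)
  moreover have "z \<bullet> e = 1 / sqrt 2" "z \<bullet> n = 1 / sqrt 2"
    using en by (simp_all add: z inner_linear ee nn inner_commute)
  ultimately have "trace_form z z = trace_form e e" "trace_form z z = trace_form n n"
    using Dz[of e] Dz[of n] by simp_all
  then show "trace_form z z = trace_form e e" "trace_form n x = trace_form e e * (n \<bullet> x)"
    using Dn[of x] by simp_all
qed

text \<open>Both \<open>e\<close> and \<open>neg_space e\<close> lie in the eigenspace of the trace
  form that contains \<open>e\<close>, so a vector orthogonal to that eigenspace lies in
  \<open>pos_space e\<close>.\<close>

lemma perp_eigenspace_in_pos_space:
  assumes "focal_codim_ge_2" "eikonal_quartic.focal_codim_ge_2 (\<lambda>x y z. - G x y z)"
    and e: "max_point e"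
    and u: "\<And>v. (\<And>x. trace_form v x = trace_form e e * (v \<bullet> x)) \<Longrightarrow> u \<bullet> v = 0"
  shows "T e e u u = (u \<bullet> u) / 3"
proof -
  interpret eikonal_max_point G e by unfold_locales fact
  have "u \<bullet> e = 0" using max_point_eigenvector[OF assms(1) e] by (intro u)
  moreover have "u \<bullet> m = 0" if m: "m \<in> neg_space e" for m
  proof (cases "m = 0")
    case False
    define n where "n = (1 / norm m) *\<^sub>R m"
    have n: "n \<in> neg_space e" "n \<bullet> n = 1"
      using False m by (simp_all add: n_def subspace_scale subspace_neg dot_square_norm power2_eq_square)
    have "u \<bullet> n = 0" using neg_space_eigenvector(2)[OF assms(1-3) n refl] by (intro u)
    then show ?thesis using False by (simp add: n_def)
  qed simp
  ultimately have "u \<in> pos_space e" by (rule pos_spaceI)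
  then show ?thesis by (rule Tee_pos)
qed

text \<open>For \<open>u\<close> orthogonal to the eigenspace of the trace form that contains \<open>e\<close>, the quadratic form
  \<open>z \<mapsto> T z z u u\<close> would be positive at the orthogonal maxima \<open>e\<close>, \<open>n\<close> and negative at the
  minima \<open>(e \<plusminus> n) / \<surd>2\<close>, against the parallelogram law.\<close>

lemma trace_form_scalar:
  assumes "focal_codim_ge_2" "eikonal_quartic.focal_codim_ge_2 (\<lambda>x y z. - G x y z)"
    and e: "max_point e"
  shows "\<exists>k::int. \<forall>x. trace_form x x = 2/3 * of_int k * (x \<bullet> x)"
proof -
  interpret eikonal_max_point G e by unfold_locales fact
  interpret neg: eikonal_quartic "\<lambda>x y z. - G x y z" by (rule eikonal_quartic_uminus)
  note cod = assms(1,2)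
  have cod': "neg.focal_codim_ge_2" "eikonal_quartic.focal_codim_ge_2 (\<lambda>x y z. - (- G x y z))"
    using cod by simp_all
  define \<mu> where "\<mu> = trace_form e e"
  have "dim (neg_space e) \<ge> 2" using cod(1) e by (simp add: focal_codim_ge_2_def)
  then have "\<not> neg_space e \<subseteq> {0}" using dim_eq_0[of "neg_space e"] by linarith
  then obtain m where m: "m \<in> neg_space e" "m \<noteq> 0" by auto
  define n where "n = (1 / norm m) *\<^sub>R m"
  have n: "n \<in> neg_space e" "n \<bullet> n = 1"
    using m by (simp_all add: n_def subspace_scale subspace_neg dot_square_norm power2_eq_square)
  have n': "- n \<in> neg_space e" "(- n) \<bullet> (- n) = 1"
    using n subspace_scale[OF subspace_neg n(1), of "-1"] by simp_all
  define z z' where "z = (1 / sqrt 2) *\<^sub>R (e + n)" and "z' = (1 / sqrt 2) *\<^sub>R (e + - n)"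
  have max_z: "neg.max_point z" "neg.max_point z'"
    unfolding z_def z'_def by (intro max_point_uminus_between e n n')+
  have tr: "trace_form n n = \<mu>" "trace_form z z = \<mu>" "trace_form z' z' = \<mu>"
    using neg_space_eigenvector[OF cod e n z_def] neg_space_eigenvector(1)[OF cod e n' z'_def]
    by (simp_all add: n \<mu>_def)
  define E where "E = {v. \<forall>x. trace_form v x = \<mu> * (v \<bullet> x)}"
  have sub: "subspace E"
    by (auto simp: E_def subspace_def trace_form_linear inner_linear algebra_simps)
  have scalar: "v \<in> E" for v
  proof -
    obtain y u where y: "y \<in> span E" and u: "\<And>w. w \<in> span E \<Longrightarrow> orthogonal u w" and v: "v = y + u"
      using orthogonal_subspace_decomp_exists[of E v] by metis
    have perp: "u \<bullet> w = 0" if "\<And>x. trace_form w x = \<mu> * (w \<bullet> x)" for w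
      using u[of w] that span_base[of w E] by (auto simp: E_def orthogonal_def)
    have "T e e u u = (u \<bullet> u) / 3"
      using perp by (intro perp_eigenspace_in_pos_space cod e) (simp add: \<mu>_def)
    moreover have "T n n u u = (u \<bullet> u) / 3"
      using perp by (intro perp_eigenspace_in_pos_space cod max_point_neg n) (simp add: tr)
    moreover have "neg.T z z u u = (u \<bullet> u) / 3" "neg.T z' z' u u = (u \<bullet> u) / 3"
      using perp by (intro neg.perp_eigenspace_in_pos_space cod' max_z; simp add: trace_form_uminus tr)+
    \<comment> \<open>The parallelogram law. The left side is -2/3 (u \<bullet> u) and the right
      side 2/3 (u \<bullet> u).\<close>
    moreover have "T z z u u + T z' z' u u = T e e u u + T n n u u"
      by (simp add: z_def z'_def T_linear field_simps)
    ultimately have "u \<bullet> u = 0" unfolding T_uminus by linarith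
    then show ?thesis using y v sub by (simp add: span_eq_iff[THEN iffD2])
  qed
  interpret mz: eikonal_max_point "\<lambda>x y z. - G x y z" z by unfold_locales (rule max_z)
  define k where "k = int (dim (neg.neg_space z)) - int (dim (neg_space e))"
  \<comment> \<open>Difference of the formula \<open>trace_form_e_e\<close> at the maximum
    \<open>e\<close> and at the minimum \<open>z\<close>, where the trace form of the negated
    quartic is \<open>- \<mu>\<close>; the ambient dimension cancels.\<close>
  have "2 * \<mu> = 4/3 * of_int k"
    using trace_form_e_e mz.trace_form_e_e by (simp add: trace_form_uminus tr \<mu>_def k_def field_simps)
  then have "\<mu> = 2/3 * of_int k" by simp
  then show ?thesis using scalar by (auto simp: E_def)
qed

text \<open>A coordinate-free primitive quartic: if a and b are the squared norms of the components
  of \<open>x\<close> in the eigenspaces of \<open>R\<close> for 1 and -1, then 2 (a - b)^2 - (a +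
  b)^2 = a^2 - 6ab + b^2.\<close>

definition reflection_quartic :: bool where
  "reflection_quartic \<longleftrightarrow> (\<exists>R. linear_reflection R \<and>
     ((\<forall>x. T x x x x = 2 * (R x \<bullet> x)^2 - (x \<bullet> x)^2) \<or>
      (\<forall>x. T x x x x = - (2 * (R x \<bullet> x)^2 - (x \<bullet> x)^2))))"

lemma linear_reflection_id: "linear_reflection (\<lambda>x::'a. x)"
  by (simp add: linear_reflection_def linear_ident)

lemma reflection_quartic_of_focal_codim:
  assumes "\<not> focal_codim_ge_2"
  shows reflection_quartic
proof -
  obtain e where e: "max_point e" and dim: "dim (neg_space e) < 2"
    using assms by (auto simp: focal_codim_ge_2_def)
  interpret eikonal_max_point G e by unfold_locales fact
  obtain C where C: "C \<subseteq> neg_space e" "\<And>x. x \<in> C \<Longrightarrow> norm x = 1"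
      "card C = dim (neg_space e)" "span C = neg_space e" "independent C"
    using orthonormal_basis_subspace[OF subspace_neg] by metis
  have "finite C" using C(5) independent_imp_finite by blast
  show ?thesis
  proof (cases "C = {}")
    case True
    then have "neg_space e = {0}" using C(4) by simp
    then have "T x x x x = 2 * (x \<bullet> x)^2 - (x \<bullet> x)^2" for x using reflection_dim_0 by simp
    then show ?thesis using linear_reflection_id by (auto simp: reflection_quartic_def)
  next
    case False
    then have "card C > 0" using \<open>finite C\<close> by (simp add: card_gt_0_iff)
    then have "card C = 1" using C(3) dim by linarith
    then obtain n where n: "C = {n}" using card_1_singletonE by blast
    interpret eikonal_max_point_hypersurface G e n
    proof
      show "n \<in> neg_space e" "neg_space e \<subseteq> span {n}" using C n by auto
      show "n \<bullet> n = 1" using C(2)[of n] n norm_eq_1 by blast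
    qed
    show ?thesis unfolding reflection_quartic_def by (rule reflection_dim_1)
  qed
qed

lemma abs_T_le: "\<bar>T x x x x\<bar> \<le> (x \<bullet> x)^2"
proof -
  have "(T x x x x)^2 \<le> (G x x x \<bullet> G x x x) * (x \<bullet> x)"
    unfolding T_def by (rule Cauchy_Schwarz_ineq)
  also have "\<dots> = ((x \<bullet> x)^2)^2" by (simp add: G_eikonal power_numeral_reduce)
  finally show ?thesis using abs_le_square_iff[of "T x x x x" "(x \<bullet> x)^2"] by simp
qed

text \<open>A maximum on the compact unit sphere is a critical point, where the eikonal equation
  forces the value 1 or -1. In the second case the lower bound from \<open>abs_T_le\<close> is
  attained everywhere.\<close>

lemma max_point_exists: "(\<exists>e. max_point e) \<or> (\<forall>x. T x x x x = - ((x \<bullet> x)^2))"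
proof -
  have "compact (sphere 0 1 :: 'a set)" by simp
  moreover have "sphere 0 1 \<noteq> ({} :: 'a set)" by simp
  moreover have "continuous_on (sphere 0 1) (\<lambda>x. T x x x x)"
    unfolding T_basis_sum by (intro continuous_intros)
  ultimately obtain e where e: "e \<in> sphere 0 1" and max: "\<And>x. x \<in> sphere 0 1 \<Longrightarrow> T x x x x \<le> T e e e e"
    using continuous_attains_sup[of "sphere 0 1" "\<lambda>x. T x x x x"] by blast
  define \<mu> where "\<mu> = T e e e e"
  have ee: "e \<bullet> e = 1" using e by (simp add: norm_eq_1)
  have bound: "T x x x x \<le> \<mu> * (x \<bullet> x)^2" for x
  proof (cases "x = 0")
    case False
    let ?y = "(1 / norm x) *\<^sub>R x"
    have "T ?y ?y ?y ?y \<le> \<mu>" unfolding \<mu>_def using False by (intro max) simp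
    then have "T x x x x / norm x ^ 4 \<le> \<mu>" by (simp add: T_linear power_numeral_reduce)
    moreover have "(x \<bullet> x)^2 = norm x ^ 4" by (simp add: dot_square_norm)
    ultimately show ?thesis using False by (simp add: divide_le_eq)
  qed (simp add: T_linear)
  have perp: "T e e e y = 0" if "e \<bullet> y = 0" for y
  proof -
    \<comment> \<open>The homogeneous bound replaces a curve on the sphere by a straight line:
      \<open>\<phi>\<close> is minimal at 0, so its derivative vanishes there.\<close>
    define \<phi> where "\<phi> r = \<mu> * (1 + r^2 * (y \<bullet> y))^2 - T (e + r *\<^sub>R y) (e + r *\<^sub>R y) (e + r *\<^sub>R y) (e + r *\<^sub>R y)" for r
    have "(\<phi> has_real_derivative - 4 * T e e e y) (at 0)"
      unfolding \<phi>_def T_expand by (auto intro!: derivative_eq_intros)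
    moreover have "\<phi> 0 \<le> \<phi> r" for r
    proof -
      have "(e + r *\<^sub>R y) \<bullet> (e + r *\<^sub>R y) = 1 + r^2 * (y \<bullet> y)"
        using that ee by (simp add: inner_linear inner_commute power2_eq_square)
      then have "0 \<le> \<phi> r" using bound[of "e + r *\<^sub>R y"] by (simp add: \<phi>_def)
      then show ?thesis by (simp add: \<phi>_def \<mu>_def)
    qed
    ultimately have "- 4 * T e e e y = 0" using DERIV_local_min[of \<phi> "- 4 * T e e e y" 0 1] by simp
    then show ?thesis by simp
  qed
  have Geee: "G e e e = \<mu> *\<^sub>R e"
  proof (rule inner_left_eqI)
    fix z
    have "e \<bullet> (z - (z \<bullet> e) *\<^sub>R e) = 0" by (simp add: inner_linear ee inner_commute)
    from perp[OF this] show "z \<bullet> G e e e = z \<bullet> (\<mu> *\<^sub>R e)"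
      by (simp add: T_linear \<mu>_def[symmetric]) (simp add: T_def inner_commute)
  qed
  then have "\<mu>^2 = 1" using G_eikonal[of e] ee by (simp add: power2_eq_square)
  then consider "\<mu> = 1" | "\<mu> = -1" by (auto simp: power2_eq_1_iff)
  then show ?thesis
  proof cases
    case 1
    then show ?thesis using Geee ee by (auto simp: max_point_def)
  next
    case 2
    have "T x x x x = - ((x \<bullet> x)^2)" for x using bound[of x] abs_T_le[of x] 2 by simp
    then show ?thesis by blast
  qed
qed

theorem trace_scalar_or_reflection:
  "(\<exists>k::int. \<forall>x. trace_form x x = 2/3 * of_int k * (x \<bullet> x)) \<or> reflection_quartic"
proof -
  interpret neg: eikonal_quartic "\<lambda>x y z. - G x y z" by (rule eikonal_quartic_uminus)
  have neg: "neg.reflection_quartic \<Longrightarrow> reflection_quartic"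
    unfolding neg.reflection_quartic_def reflection_quartic_def T_uminus
    by (metis add.inverse_inverse)
  consider e where "max_point e" | "\<forall>x. T x x x x = - ((x \<bullet> x)^2)" using max_point_exists by blast
  then show ?thesis
  proof cases
    case 1
    then show ?thesis
      using trace_form_scalar reflection_quartic_of_focal_codim neg.reflection_quartic_of_focal_codim neg
      by blast
  next
    case 2
    then have "T x x x x = - (2 * (x \<bullet> x)^2 - (x \<bullet> x)^2)" for x by simp
    then show ?thesis using linear_reflection_id by (auto simp: reflection_quartic_def)
  qed
qed

end

section \<open>Polynomials on coordinate space\<close>

lemma prim_quartic_Compl: "prim_quartic (UNIV - S) = prim_quartic S"
  by (rule ext) (simp add: prim_quartic_def double_diff)

text \<open>\<open>U\<close> takes coordinates in an orthonormal eigenbasis of \<open>R\<close>, and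
  \<open>S\<close> indexes the eigenvectors for 1. The coordinates in \<open>S\<close> and outside
  it have square sums \<open>(x \<bullet> x + R x \<bullet> x) / 2\<close> and
  \<open>(x \<bullet> x - R x \<bullet> x) / 2\<close>.\<close>

lemma reflection_quartic_eq_prim_quartic:
  fixes R :: "real ^ 'n \<Rightarrow> real ^ 'n"
  assumes "linear_reflection R"
  shows "\<exists>(S :: 'n set) U. orthogonal_transformation U \<and>
    (\<forall>x. prim_quartic S (U x) = 2 * (R x \<bullet> x)^2 - (x \<bullet> x)^2)"
proof -
  have lin: "linear R" and sym: "\<And>x y. R x \<bullet> y = x \<bullet> R y" and inv: "\<And>x. R (R x) = x"
    using assms by (auto simp: linear_reflection_def)
  define V where "V s = {x. R x = s *\<^sub>R x}" for s :: real
  have "subspace (V s)" for s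
    by (auto simp: V_def subspace_def linear_0[OF lin] linear_add[OF lin] linear_scale[OF lin] algebra_simps)
  then have "\<exists>C. C \<subseteq> V s \<and> pairwise orthogonal C \<and> (\<forall>x\<in>C. norm x = 1) \<and> finite C \<and> span C = V s" for s
    using orthonormal_basis_subspace[of "V s"] independent_imp_finite by metis
  then obtain C where C: "\<And>s. C s \<subseteq> V s" "\<And>s. pairwise orthogonal (C s)"
      "\<And>s x. x \<in> C s \<Longrightarrow> norm x = 1" "\<And>s. finite (C s)" "\<And>s. span (C s) = V s"
    by metis
  let ?A = "C 1" and ?B = "C (-1)"
  have perp: "a \<bullet> b = 0" "b \<bullet> a = 0" if "a \<in> ?A" "b \<in> ?B" for a b
  proof -
    have "R a = a" "R b = - b" using that C(1)[of 1] C(1)[of "-1"] by (auto simp: V_def)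
    then show "a \<bullet> b = 0" "b \<bullet> a = 0" using sym[of a b] by (simp_all add: inner_commute)
  qed
  have disj: "?A \<inter> ?B = {}"
    using perp C(3) by (metis disjoint_iff inner_eq_zero_iff norm_zero zero_neq_one)
  have orth: "pairwise orthogonal (?A \<union> ?B)"
    using C(2)[of 1] C(2)[of "-1"] perp
    by (auto simp: pairwise_def orthogonal_def)
  have part: "(1/2) *\<^sub>R (x + R x) \<in> span ?A" "(1/2) *\<^sub>R (x - R x) \<in> span ?B" for x
    by (simp_all add: C(5) V_def linear_add[OF lin] linear_diff[OF lin] linear_scale[OF lin] inv algebra_simps)
  have span: "span (?A \<union> ?B) = UNIV"
  proof -
    have "x \<in> span (?A \<union> ?B)" for x
    proof -
      have "x = (1/2) *\<^sub>R (x + R x) + (1/2) *\<^sub>R (x - R x)"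
        by (simp add: scaleR_add_right scaleR_diff_right flip: scaleR_left_distrib)
      moreover have "(1/2) *\<^sub>R (x + R x) + (1/2) *\<^sub>R (x - R x) \<in> span (?A \<union> ?B)"
        using part[of x] span_mono[of ?A "?A \<union> ?B"] span_mono[of ?B "?A \<union> ?B"]
        by (intro span_add) auto
      ultimately show ?thesis by simp
    qed
    then show ?thesis by blast
  qed
  have "0 \<notin> ?A \<union> ?B" using C(3) by (metis Un_iff norm_zero zero_neq_one)
  then have "independent (?A \<union> ?B)" using orth by (simp add: pairwise_orthogonal_independent)
  then have "card (?A \<union> ?B) = CARD('n)"
    using span by (metis dim_span_eq_card_independent dim_UNIV DIM_cart DIM_real mult.right_neutral)
  then obtain \<phi> where \<phi>: "bij_betw \<phi> (UNIV :: 'n set) (?A \<union> ?B)"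
    using C(4) by (metis finite_UnI finite_class.finite_UNIV finite_same_card_bij)
  have inj: "inj \<phi>" and ran: "range \<phi> = ?A \<union> ?B" using \<phi> by (auto simp: bij_betw_def)
  define S where "S = \<phi> -` ?A"
  define U where "U x = (\<chi> i. x \<bullet> \<phi> i)" for x :: "real ^ 'n"
  have imA: "\<phi> ` S = ?A" using ran by (auto simp: S_def)
  then have imB: "\<phi> ` (UNIV - S) = ?B"
    using image_set_diff[OF inj, of UNIV S] ran disj by auto
  have sumA: "(\<Sum>i\<in>S. (U x $ i)^2) = (x \<bullet> x + R x \<bullet> x) / 2" for x
  proof -
    have "(\<Sum>i\<in>S. (U x $ i)^2) = (\<Sum>c\<in>?A. (x \<bullet> c)^2)"
      unfolding imA[symmetric] by (subst sum.reindex) (use inj in \<open>auto simp: U_def inj_on_def\<close>)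
    \<comment> \<open>Projecting \<open>x\<close> to the eigenspace leaves its inner products with
      \<open>c\<close> unchanged and places it in \<open>span ?A\<close>, where
      \<open>orthonormal_inner_self\<close> applies.\<close>
    also have "\<dots> = (\<Sum>c\<in>?A. (((1/2) *\<^sub>R (x + R x)) \<bullet> c)^2)"
    proof (rule sum.cong[OF refl])
      show "(x \<bullet> c)^2 = (((1/2) *\<^sub>R (x + R x)) \<bullet> c)^2" if "c \<in> ?A" for c
        using that C(1)[of 1] sym[of x c] by (auto simp: V_def inner_linear)
    qed
    also have "\<dots> = ((1/2) *\<^sub>R (x + R x)) \<bullet> ((1/2) *\<^sub>R (x + R x))"
      by (rule orthonormal_inner_self[symmetric]) (use C part in auto)
    also have "\<dots> = (x \<bullet> x + R x \<bullet> x) / 2"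
      using sym[of x "R x"] by (simp add: inner_linear inv inner_commute)
    finally show ?thesis .
  qed
  have sumB: "(\<Sum>i\<in>UNIV - S. (U x $ i)^2) = (x \<bullet> x - R x \<bullet> x) / 2" for x
  proof -
    have "(\<Sum>i\<in>UNIV - S. (U x $ i)^2) = (\<Sum>c\<in>?B. (x \<bullet> c)^2)"
      unfolding imB[symmetric] by (subst sum.reindex) (use inj in \<open>auto simp: U_def inj_on_def\<close>)
    also have "\<dots> = (\<Sum>c\<in>?B. (((1/2) *\<^sub>R (x - R x)) \<bullet> c)^2)"
    proof (rule sum.cong[OF refl])
      show "(x \<bullet> c)^2 = (((1/2) *\<^sub>R (x - R x)) \<bullet> c)^2" if "c \<in> ?B" for c
        using that C(1)[of "-1"] sym[of x c] by (auto simp: V_def inner_linear)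
    qed
    also have "\<dots> = ((1/2) *\<^sub>R (x - R x)) \<bullet> ((1/2) *\<^sub>R (x - R x))"
      by (rule orthonormal_inner_self[symmetric]) (use C part in auto)
    also have "\<dots> = (x \<bullet> x - R x \<bullet> x) / 2"
      using sym[of x "R x"] by (simp add: inner_linear inv inner_commute)
    finally show ?thesis .
  qed
  have sum: "(\<Sum>i\<in>UNIV. (U x $ i)^2) = x \<bullet> x" for x
    using sumA[of x] sumB[of x] sum.subset_diff[of S UNIV "\<lambda>i. (U x $ i)^2"] by simp
  have "linear U"
    by (rule linearI) (simp_all add: U_def vec_eq_iff inner_linear)
  moreover have "norm (U x) = norm x" for x
    using sum[of x] by (simp add: norm_eq_sqrt_inner inner_vec_def power2_eq_square)
  ultimately have "orthogonal_transformation U" by (simp add: orthogonal_transformation)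
  moreover have "prim_quartic S (U x) = 2 * (R x \<bullet> x)^2 - (x \<bullet> x)^2" for x
    unfolding prim_quartic_def sum sumA sumB by (simp add: field_simps power2_eq_square)
  ultimately show ?thesis by blast
qed

text \<open>\<open>S\<close> and its complement give the same quartic, so the smaller of the two can
  be taken.\<close>

lemma congruent_prim_quartic_of_reflection:
  fixes R :: "real ^ 'n \<Rightarrow> real ^ 'n" and f :: "real ^ 'n \<Rightarrow> real"
  assumes "linear_reflection R"
    and "(\<forall>x. f x = 2 * (R x \<bullet> x)^2 - (x \<bullet> x)^2) \<or> (\<forall>x. f x = - (2 * (R x \<bullet> x)^2 - (x \<bullet> x)^2))"
  shows "\<exists>k S. k \<le> CARD('n) div 2 \<and> card S = k \<and> congruent (prim_quartic S) f"
proof -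
  obtain S :: "'n set" and U where U: "orthogonal_transformation U"
      "\<And>x. prim_quartic S (U x) = 2 * (R x \<bullet> x)^2 - (x \<bullet> x)^2"
    using reflection_quartic_eq_prim_quartic[OF assms(1)] by blast
  then have "congruent (prim_quartic S) f" "congruent (prim_quartic (UNIV - S)) f"
    using assms(2) unfolding congruent_def prim_quartic_Compl by auto
  moreover have "card (UNIV - S) = CARD('n) - card S" by (simp add: card_Diff_subset)
  then have "card S \<le> CARD('n) div 2 \<or> card (UNIV - S) \<le> CARD('n) div 2" by linarith
  ultimately show ?thesis by blast
qed

lemma hom_quartic_obtains_quartic_form:
  fixes f :: "real ^ 'n \<Rightarrow> real"
  assumes "hom_quartic f"
  obtains G where "quartic_form G" "\<And>x. f x = G x x x \<bullet> x"
proof -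
  obtain c where c: "\<And>x. f x = (\<Sum>i\<in>UNIV. \<Sum>j\<in>UNIV. \<Sum>k\<in>UNIV. \<Sum>l\<in>UNIV.
      c i j k l * x$i * x$j * x$k * x$l)"
    using assms by (auto simp: hom_quartic_def)
  define F where "F x y z w = (\<Sum>i\<in>UNIV. \<Sum>j\<in>UNIV. \<Sum>k\<in>UNIV. \<Sum>l\<in>UNIV.
      c i j k l * x$i * y$j * z$k * w$l)" for x y z w :: "real ^ 'n"
  have add: "F (x + x') y z w = F x y z w + F x' y z w" "F x (y + y') z w = F x y z w + F x y' z w"
    "F x y (z + z') w = F x y z w + F x y z' w" "F x y z (w + w') = F x y z w + F x y z w'"
    for x x' y y' z z' w w'
    by (simp_all add: F_def sum.distrib distrib_left distrib_right)
  have scale: "F (r *\<^sub>R x) y z w = r * F x y z w" "F x (r *\<^sub>R y) z w = r * F x y z w"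
    "F x y (r *\<^sub>R z) w = r * F x y z w" "F x y z (r *\<^sub>R w) = r * F x y z w" for r x y z w
    by (simp_all add: F_def sum_distrib_left mult_ac)
  \<comment> \<open>\<open>T\<close> averages \<open>F\<close> over all 24 permutations of its arguments.\<close>
  define H where "H x y z w = F x y z w + F y x z w" for x y z w
  define Q where "Q x y z w = H x y z w + H y z x w + H z x y w" for x y z w
  define T where "T x y z w = (Q x y z w + Q y z w x + Q z w x y + Q w x y z) / 24" for x y z w
  have sym: "T x y z w = T y x z w" "T x y z w = T x z y w" "T x y z w = T x y w z" for x y z w
    by (simp_all add: T_def Q_def H_def)
  have T_add: "T (x + x') y z w = T x y z w + T x' y z w" for x x' y z w
    by (simp add: T_def Q_def H_def add algebra_simps add_divide_distrib)
  have T_scale: "T (r *\<^sub>R x) y z w = r * T x y z w" for r x y z w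
    by (simp add: T_def Q_def H_def scale algebra_simps)
  have T4: "linear (T x y z)" for x y z
    by (rule linearI) (metis sym T_add, metis sym T_scale real_scaleR_def)
  define G where "G x y z = (\<chi> i. T x y z (axis i 1))" for x y z
  have G_inner: "G x y z \<bullet> w = T x y z w" for x y z w
  proof -
    have "T x y z w = T x y z (\<Sum>i\<in>UNIV. w$i *\<^sub>R axis i 1)"
      using basis_expansion[of w] by (simp add: scalar_mult_eq_scaleR)
    also have "\<dots> = (\<Sum>i\<in>UNIV. w$i * T x y z (axis i 1))"
      by (simp add: linear_sum[OF T4] linear_scale[OF T4])
    finally show ?thesis by (simp add: inner_vec_def G_def mult.commute)
  qed
  have "quartic_form G"
  proof
    show "G x y z = G y x z" "G x y z = G x z y" for x y z
      using sym(1)[of x y z] sym(2)[of x y z] by (simp_all add: G_def vec_eq_iff)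
    show "G x y z \<bullet> w = G x y w \<bullet> z" for x y z w by (simp add: G_inner sym(3)[of x y z])
  qed (simp_all add: G_def vec_eq_iff T_add T_scale)
  moreover have "f x = G x x x \<bullet> x" for x
    by (simp add: G_inner T_def Q_def H_def c F_def)
  ultimately show thesis by (rule that)
qed

section \<open>Gradient and Laplacian of the quartic\<close>

lemma sum_Basis_vec:
  fixes h :: "real ^ 'n \<Rightarrow> real"
  shows "(\<Sum>b\<in>Basis. h b) = (\<Sum>i\<in>UNIV. h (axis i 1))"
proof -
  have Basis: "(Basis :: (real ^ 'n) set) = range (\<lambda>i. axis i 1)" by (auto simp: Basis_vec_def)
  have "inj (\<lambda>i. axis i 1 :: real ^ 'n)" by (auto simp: inj_on_def axis_eq_axis)
  from sum.reindex[OF this, of h] show ?thesis by (simp add: Basis)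
qed

context
  fixes G :: "real ^ 'n \<Rightarrow> real ^ 'n \<Rightarrow> real ^ 'n \<Rightarrow> real ^ 'n"
  assumes G: "quartic_form G"
begin

interpretation quartic_form G by (rule G)

text \<open>By \<open>T_expand\<close> the restriction to a coordinate line is a polynomial in
  \<open>r\<close>, whose linear coefficient is the derivative at 0.\<close>

lemma partial_quartic: "partial i (\<lambda>x. T x x x x) x = 4 * T x x x (axis i 1)"
proof -
  have "((\<lambda>r. T (x + r *\<^sub>R axis i 1) (x + r *\<^sub>R axis i 1) (x + r *\<^sub>R axis i 1) (x + r *\<^sub>R axis i 1))
      has_real_derivative 4 * T x x x (axis i 1)) (at 0)"
    unfolding T_expand by (auto intro!: derivative_eq_intros)
  then show ?thesis unfolding partial_def by (rule DERIV_imp_deriv)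
qed

lemma partial_partial_quartic:
  "partial i (partial i (\<lambda>x. T x x x x)) x = 12 * T x x (axis i 1) (axis i 1)"
proof -
  let ?a = "axis i 1 :: real ^ 'n"
  have sw: "T x x x ?a = T ?a x x x" for x by (simp add: T_swap)
  have sw': "T ?a x x ?a = T x x ?a ?a" by (simp add: T_swap)
  have "((\<lambda>r. 4 * T ?a (x + r *\<^sub>R ?a) (x + r *\<^sub>R ?a) (x + r *\<^sub>R ?a)) has_real_derivative 12 * T ?a x x ?a) (at 0)"
    unfolding T_expand_cubic by (auto intro!: derivative_eq_intros)
  then show ?thesis
    unfolding partial_def[of i "partial i (\<lambda>x. T x x x x)"] partial_quartic sw sw'[symmetric]
    by (rule DERIV_imp_deriv)
qed

lemma laplacian_quartic: "laplacian (\<lambda>x. T x x x x) x = 12 * trace_form x x"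
  by (simp add: laplacian_def partial_partial_quartic trace_form_def sum_Basis_vec sum_distrib_left)

lemma grad_sq_quartic: "grad_sq (\<lambda>x. T x x x x) x = 16 * (G x x x \<bullet> G x x x)"
proof -
  have "T x x x (axis i 1) = G x x x $ i" for i by (simp add: T_def inner_axis)
  then show ?thesis
    by (simp add: grad_sq_def partial_quartic inner_vec_def sum_distrib_left power2_eq_square)
qed

end

theorem theorem1p3:
  fixes f :: "real ^ 'n \<Rightarrow> real"
  assumes "hom_quartic f"
    and "\<forall>x. grad_sq f x = 16 * norm x ^ 6"
  shows "isoparametric 4 f \<or>
    (\<exists>k S. k \<le> CARD('n) div 2 \<and> card S = k \<and> congruent (prim_quartic S) f)"
proof -
  obtain G where G: "quartic_form G" and f: "\<And>x. f x = G x x x \<bullet> x"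
    using hom_quartic_obtains_quartic_form[OF assms(1)] by blast
  interpret quartic_form G by (rule G)
  have f_T: "f = (\<lambda>x. T x x x x)" by (simp add: fun_eq_iff f T_def)
  interpret eikonal_quartic G
  proof
    fix x :: "real ^ 'n"
    have "norm x ^ 6 = (x \<bullet> x)^3" by (simp add: dot_square_norm flip: power_mult)
    then show "G x x x \<bullet> G x x x = (x \<bullet> x)^3"
      using assms(2) grad_sq_quartic[OF G, of x] by (simp add: f_T)
  qed
  from trace_scalar_or_reflection show ?thesis
  proof
    assume "\<exists>k::int. \<forall>x. trace_form x x = 2/3 * of_int k * (x \<bullet> x)"
    then obtain k :: int where k: "\<And>x. trace_form x x = 2/3 * of_int k * (x \<bullet> x)" by blast
    \<comment> \<open>The witnesses are m2 = k and m1 = 0: the Laplacian is 12 times the trace form,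
      and 12 * 2/3 = 8 = 16 / 2.\<close>
    have "laplacian f x = real_of_int (k - 0) / 2 * real 4 ^ 2 * norm x ^ (4 - 2)" for x
      by (simp add: f_T laplacian_quartic[OF G] k dot_square_norm)
    moreover have "eikonal 4 f" using assms(2) by (simp add: eikonal_def)
    ultimately show ?thesis unfolding isoparametric_def by blast
  next
    assume reflection_quartic
    then show ?thesis
      using congruent_prim_quartic_of_reflection[of _ f] by (auto simp: reflection_quartic_def f_T)
  qed
qed

end
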